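(* Let $\{r,s,t\}=\{1,2,3\}$ and let $\mathbb A=\mathbb A^3_r(p_1,\dots,p_6)$ be defined by six real parameters $p_1,\dots,p_6$. Let $F=(f_1,f_2,f_3)$ be an $\mathbb A$-algebrizable vector field defined on an open set $\Omega\subset\mathbb R^3$, and $E_i:=e_iF$ (product in $\mathbb A$) for $i=1,2,3$. Then $$E_r=F,$$ $$E_s=(p_7f_s+p_8f_t)e_r+(f_r+p_1f_s+p_3f_t)e_s+(p_2f_s+p_4f_t)e_t,$$ $$E_t=(p_8f_s+p_9f_t)e_r+(p_3f_s+p_5f_t)e_s+(f_r+p_4f_s+p_6f_t)e_t.$$ In addition, $$\int_\gamma\frac eF\,d\xi=\left(\int_\gamma G_1\cdot ds,\int_\gamma G_2\cdot ds,\int_\gamma G_3\cdot ds\right)$$ for every differentiable path $\gamma$ contained in $\Omega(F,\mathbb A^* )$, where $G_r,G_s,G_t$ are the vector fields, conservative on every simply connected open subset of $\Omega(F,\mathbb A^* )$, given by \begin{align*} G_r=\frac1{\det(R(F))}\Big[&\big[f_r^2+(p_1+p_4)f_rf_s+(p_3+p_6)f_rf_t+(p_1p_4-p_2p_3)f_s^2+(p_1p_6-p_2p_5)f_sf_t+(p_3p_6-p_4p_5)f_t^2\big]e_r\\ &+\big[-p_7f_rf_s-p_8f_rf_t+(p_2p_8-p_4p_7)f_s^2+(p_2p_9-p_6p_7)f_sf_t+(p_5p_7-p_3p_8)f_t^2\big]e_s\\ &+\big[-p_8f_rf_s-p_9f_rf_t+(p_2p_9-p_4p_8)f_s^2+(p_5p_7-p_1p_9)f_sf_t+(p_5p_8-p_3p_9)f_t^2\big]e_t\Big],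 \end{align*} \begin{align*} G_s=\frac1{\det(R(F))}\Big[&\big[-f_rf_s-p_4f_s^2-(p_6-p_3)f_sf_t+p_5f_t^2\big]e_r+\big[f_r^2+p_4f_rf_s+p_6f_rf_t-p_8f_sf_t-p_9f_t^2\big]e_s\\ &-\big[p_3f_rf_s-p_8f_s^2+p_5f_rf_t-p_9f_sf_t\big]e_t\Big], \end{align*} \begin{align*} G_t=\frac1{\det(R(F))}\Big[&\big[p_2f_s^2-f_rf_t-(p_1-p_4)f_sf_t-p_3f_t^2\big]e_r-\big[p_2f_rf_s+p_4f_rf_t-p_7f_sf_t-p_8f_t^2\big]e_s\\ &+\big[f_r^2+p_1f_rf_s+p_3f_rf_t-p_7f_s^2-p_8f_sf_t\big]e_t\Big]. \end{align*} Moreover, $\langle E_i,G_j\rangle=\delta_{ij}$ for $i,j\in\{1,2,3\}$. Thus, a potential function $h_i$ of $G_i$ (on a simply connected open subset of $\Omega(F,\mathbb A^* )$) is a first integral of $E_j$ for $i,j\in\{1,2,3\}$, $i\ne j$.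
   Context: $\mathbb A^3_r(p_1,\dots,p_6)$ denotes $\mathbb R^3$ (canonical basis $e_1,e_2,e_3$) with the commutative associative product having unit $e=e_r$ and $e_se_s=p_7e_r+p_1e_s+p_2e_t$, $e_se_t=p_8e_r+p_3e_s+p_4e_t$, $e_te_t=p_9e_r+p_5e_s+p_6e_t$, where $p_7=p_2p_3+p_4^2-p_1p_4-p_2p_6$, $p_8=p_2p_5-p_3p_4$, $p_9=p_3^2+p_4p_5-p_1p_5-p_3p_6$. $\mathbb A^*$ is the set of invertible elements, the inverse of $a$ being $\frac ea$. A vector field $F:\Omega\to\mathbb R^3$ is $\mathbb A$-algebrizable if there is $F':\Omega\to\mathbb R^3$ with $\lim_{\xi\to0}|F(w+\xi)-F(w)-F'(w)\xi|/|\xi|=0$ for all $w\in\Omega$ (product in $\mathbb A$). $\Omega(F,\mathbb A^* )=F^{-1}(\mathbb A^* )$. For $a\in\mathbb A$, $R(a)$ is the matrix of the linear map $v\mapsto av$ in the canonical basis, and $R(F)$ is the function $w\mapsto R(F(w))$; $\det(R(F))\neq0$ exactly on $\Omega(F,\mathbb A^* )$. For a (piecewise continuously) differentiable curve $\gamma:[0,a]\to\Omega(F,\mathbb A^* )$: $\int_\gamma\frac eFd\xi=\int_0^a\frac e{F(\gamma(t))}\dot\gamma(t)\,dt$ (product in $\mathbb A$), $\int_\gamma G\cdot ds=\int_0^a\langle G(\gamma(t)),\dot\gamma(t)\rangle dt$. A potential of $G$ is $h$ with $\nabla h=G$; a first integral of $E$ is a differentiable $h$ with $\langle\nabla h,E\rangle=0$.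 *)

theory Defs
  imports "HOL-Analysis.Analysis"
begin

text \<open>
  The algebra \<open>A^3_r(p_1,...,p_6)\<close> lives on \<^typ>\<open>real^3\<close>, whose canonical basis vector \<open>e_i\<close> is
  \<open>axis i 1\<close>.  The indices \<open>r, s, t\<close> have type \<^typ>\<open>3\<close> (where \<open>3 = 0\<close>), and the six
  parameters are the components of a vector of type \<^typ>\<open>real^6\<close> (where \<open>6 = 0\<close>).
  All definitions below that take \<open>r, s, t\<close> are meant for \<open>{r, s, t} = {1, 2, 3}\<close>.
\<close>

definition p7 :: "real^6 \<Rightarrow> real" where
  "p7 p = p$2 * p$3 + (p$4)\<^sup>2 - p$1 * p$4 - p$2 * p$6"

definition p8 :: "real^6 \<Rightarrow> real" where
  "p8 p = p$2 * p$5 - p$3 * p$4"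

definition p9 :: "real^6 \<Rightarrow> real" where
  "p9 p = (p$3)\<^sup>2 + p$4 * p$5 - p$1 * p$5 - p$3 * p$6"

definition basis_prod :: "3 \<Rightarrow> 3 \<Rightarrow> 3 \<Rightarrow> real^6 \<Rightarrow> 3 \<Rightarrow> 3 \<Rightarrow> real^3" where
  "basis_prod r s t p i j =
    (if i = r then axis j 1
     else if j = r then axis i 1
     else if i = s \<and> j = s then p7 p *\<^sub>R axis r 1 + p$1 *\<^sub>R axis s 1 + p$2 *\<^sub>R axis t 1
     else if i = t \<and> j = t then p9 p *\<^sub>R axis r 1 + p$5 *\<^sub>R axis s 1 + p$6 *\<^sub>R axis t 1
     else p8 p *\<^sub>R axis r 1 + p$3 *\<^sub>R axis s 1 + p$4 *\<^sub>R axis t 1)"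

definition amult :: "3 \<Rightarrow> 3 \<Rightarrow> 3 \<Rightarrow> real^6 \<Rightarrow> real^3 \<Rightarrow> real^3 \<Rightarrow> real^3" where
  "amult r s t p x y = (\<Sum>i\<in>UNIV. \<Sum>j\<in>UNIV. (x$i * y$j) *\<^sub>R basis_prod r s t p i j)"

definition aunits :: "3 \<Rightarrow> 3 \<Rightarrow> 3 \<Rightarrow> real^6 \<Rightarrow> (real^3) set" where
  "aunits r s t p = {a. \<exists>b. amult r s t p a b = axis r 1}"

text \<open>The inverse \<open>e/a\<close>; only meaningful for \<open>a \<in> aunits r s t p\<close>.\<close>

definition ainverse :: "3 \<Rightarrow> 3 \<Rightarrow> 3 \<Rightarrow> real^6 \<Rightarrow> real^3 \<Rightarrow> real^3" where
  "ainverse r s t p a = (THE b. amult r s t p a b = axis r 1)"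

definition algebrizable_on ::
    "3 \<Rightarrow> 3 \<Rightarrow> 3 \<Rightarrow> real^6 \<Rightarrow> (real^3) set \<Rightarrow> (real^3 \<Rightarrow> real^3) \<Rightarrow> bool" where
  "algebrizable_on r s t p \<Omega> F \<longleftrightarrow>
    (\<exists>F'. \<forall>w\<in>\<Omega>.
      ((\<lambda>\<xi>. norm (F (w + \<xi>) - F w - amult r s t p (F' w) \<xi>) / norm \<xi>) \<longlongrightarrow> 0) (at 0))"

definition unit_domain ::
    "3 \<Rightarrow> 3 \<Rightarrow> 3 \<Rightarrow> real^6 \<Rightarrow> (real^3) set \<Rightarrow> (real^3 \<Rightarrow> real^3) \<Rightarrow> (real^3) set" where
  "unit_domain r s t p \<Omega> F = {w\<in>\<Omega>. F w \<in> aunits r s t p}"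

definition mult_matrix :: "3 \<Rightarrow> 3 \<Rightarrow> 3 \<Rightarrow> real^6 \<Rightarrow> real^3 \<Rightarrow> real^3^3" where
  "mult_matrix r s t p a = matrix (amult r s t p a)"

text \<open>
  Integrands of the two line integrals along \<open>\<gamma> : [0,a] \<rightarrow> \<real>\<^sup>3\<close>.  At the finitely many points where
  \<open>\<gamma>\<close> may fail to be differentiable the value is unspecified, which does not affect the integrals.
\<close>

definition alg_line_integrand :: "3 \<Rightarrow> 3 \<Rightarrow> 3 \<Rightarrow> real^6 \<Rightarrow> real \<Rightarrow> (real \<Rightarrow> real^3)
    \<Rightarrow> (real^3 \<Rightarrow> real^3) \<Rightarrow> real \<Rightarrow> real^3" where
  "alg_line_integrand r s t p a \<gamma> H =
    (\<lambda>\<tau>. amult r s t p (H (\<gamma> \<tau>)) (vector_derivative \<gamma> (at \<tau> within {0..a})))"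

definition line_integrand ::
    "real \<Rightarrow> (real \<Rightarrow> real^3) \<Rightarrow> (real^3 \<Rightarrow> real^3) \<Rightarrow> real \<Rightarrow> real" where
  "line_integrand a \<gamma> G = (\<lambda>\<tau>. inner (G (\<gamma> \<tau>)) (vector_derivative \<gamma> (at \<tau> within {0..a})))"

definition potential_on :: "(real^3) set \<Rightarrow> (real^3 \<Rightarrow> real^3) \<Rightarrow> (real^3 \<Rightarrow> real) \<Rightarrow> bool" where
  "potential_on U G h \<longleftrightarrow> (\<forall>x\<in>U. GDERIV h x :> G x)"

definition conservative_on :: "(real^3) set \<Rightarrow> (real^3 \<Rightarrow> real^3) \<Rightarrow> bool" where
  "conservative_on U G \<longleftrightarrow> (\<exists>h. potential_on U G h)"

definition first_integral_on :: "(real^3) set \<Rightarrow> (real^3 \<Rightarrow> real^3) \<Rightarrow> (real^3 \<Rightarrow> real) \<Rightarrow> bool" where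
  "first_integral_on U E h \<longleftrightarrow> (\<forall>x\<in>U. \<exists>D. (GDERIV h x :> D) \<and> inner D (E x) = 0)"

definition E_field :: "3 \<Rightarrow> 3 \<Rightarrow> 3 \<Rightarrow> real^6 \<Rightarrow> (real^3 \<Rightarrow> real^3) \<Rightarrow> 3 \<Rightarrow> real^3 \<Rightarrow> real^3" where
  "E_field r s t p F i w = amult r s t p (axis i 1) (F w)"

definition G_field :: "3 \<Rightarrow> 3 \<Rightarrow> 3 \<Rightarrow> real^6 \<Rightarrow> (real^3 \<Rightarrow> real^3) \<Rightarrow> 3 \<Rightarrow> real^3 \<Rightarrow> real^3" where
  "G_field r s t p F k w =
    (let fr = F w $ r; fs = F w $ s; ft = F w $ t;
         p1 = p$1; p2 = p$2; p3 = p$3; p4 = p$4; p5 = p$5; p6 = p$6;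
         p7 = p7 p; p8 = p8 p; p9 = p9 p
     in (1 / det (mult_matrix r s t p (F w))) *\<^sub>R
      (if k = r then
         (fr\<^sup>2 + (p1 + p4) * fr * fs + (p3 + p6) * fr * ft + (p1 * p4 - p2 * p3) * fs\<^sup>2
            + (p1 * p6 - p2 * p5) * fs * ft + (p3 * p6 - p4 * p5) * ft\<^sup>2) *\<^sub>R axis r 1
       + (- p7 * fr * fs - p8 * fr * ft + (p2 * p8 - p4 * p7) * fs\<^sup>2
            + (p2 * p9 - p6 * p7) * fs * ft + (p5 * p7 - p3 * p8) * ft\<^sup>2) *\<^sub>R axis s 1
       + (- p8 * fr * fs - p9 * fr * ft + (p2 * p9 - p4 * p8) * fs\<^sup>2
            + (p5 * p7 - p1 * p9) * fs * ft + (p5 * p8 - p3 * p9) * ft\<^sup>2) *\<^sub>R axis t 1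
       else if k = s then
         (- fr * fs - p4 * fs\<^sup>2 - (p6 - p3) * fs * ft + p5 * ft\<^sup>2) *\<^sub>R axis r 1
       + (fr\<^sup>2 + p4 * fr * fs + p6 * fr * ft - p8 * fs * ft - p9 * ft\<^sup>2) *\<^sub>R axis s 1
       - (p3 * fr * fs - p8 * fs\<^sup>2 + p5 * fr * ft - p9 * fs * ft) *\<^sub>R axis t 1
       else
         (p2 * fs\<^sup>2 - fr * ft - (p1 - p4) * fs * ft - p3 * ft\<^sup>2) *\<^sub>R axis r 1
       - (p2 * fr * fs + p4 * fr * ft - p7 * fs * ft - p8 * ft\<^sup>2) *\<^sub>R axis s 1
       + (fr\<^sup>2 + p1 * fr * fs + p3 * fr * ft - p7 * fs\<^sup>2 - p8 * fs * ft) *\<^sub>R axis t 1))"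

end

theory Submission
  imports Defs
begin

text \<open>
  Everything comes from the matrix \<open>R(F)\<close> of multiplication by \<open>F\<close>.  Since the product is commutative, the
  columns of \<open>R(F)\<close> are the fields \<open>E\<^sub>i = e\<^sub>i F\<close>, and the listed fields \<open>G\<^sub>j\<close> are the rows of the adjugate
  of \<open>R(F)\<close> divided by its determinant.  So \<open>\<langle>E\<^sub>i, G\<^sub>j\<rangle> = \<delta>\<^sub>i\<^sub>j\<close> is Cramer's rule, verified as nine polynomial
  identities in \<open>dual_row_inner\<close>.  Since the product is associative, the inverse matrix \<open>R(F)\<^sup>-\<^sup>1\<close> is
  multiplication by \<open>e/F\<close>; hence the \<open>k\<close>-th component of \<open>(e/F) v\<close> is \<open>\<langle>G\<^sub>k, v\<rangle>\<close>, which gives the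
  equality of the integrals componentwise.  The statement about first integrals is the duality relation again.

  The analytic content is that the vector-valued one-form \<open>v \<mapsto> (e/F) v\<close> is exact on simply connected open sets.
  By the product rule applied to \<open>F (e/F) = e\<close>, its derivative in direction \<open>u\<close> is
  \<open>v \<mapsto> - (e/F)\<^sup>2 F' u v\<close>, which is symmetric in \<open>u\<close> and \<open>v\<close> because the algebra is
  commutative (\<open>closed_inverse_form\<close>).  The function \<open>F'\<close> need not be continuous, so Stokes' theorem does not apply.
  Instead, Goursat's subdivision of triangles works for one-forms on Euclidean space that are differentiable
  with symmetric derivative at each point: near a point such a form differs from a form with a quadratic
  primitive by an error of higher order (\<open>goursat_triangle\<close>).  This gives primitives on convex open
  sets.  To pass to simply connected sets, sums of integrals over inscribed polygons are compared along a
  homotopy, cell by cell of a fine grid (\<open>grid_sum_homotopic\<close>), and a primitive is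
  defined by transport along paths from a base point (\<open>exact_on_balls_imp_exact\<close>).

  The local primitives also give the existence of the line integrals.  A piecewise differentiable
  curve need not have an integrable velocity in the sense of Lebesgue, but locally the integrand is the
  derivative of a primitive composed with the curve, and such a derivative is integrable in the sense of
  Henstock and Kurzweil (\<open>closed_line_integral_integrable\<close>).
\<close>

section \<open>One-forms integrated along segments\<close>

definition seg_int :: "('a::euclidean_space \<Rightarrow> 'a \<Rightarrow>\<^sub>L 'b::banach) \<Rightarrow> 'a \<Rightarrow> 'a \<Rightarrow> 'b" where
  "seg_int \<omega> a b = integral {0..1} (\<lambda>t. \<omega> (a + t *\<^sub>R (b - a)) (b - a))"

lemma seg_point_in_segment:
  fixes a b :: "'a::real_vector"
  assumes "t \<in> {0..1}"
  shows "a + t *\<^sub>R (b - a) \<in> closed_segment a b"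
  using assms unfolding closed_segment_def
  by (intro CollectI exI[of _ t]) (simp add: algebra_simps)

lemma continuous_on_seg_integrand:
  assumes "continuous_on (closed_segment a b) \<omega>"
  shows "continuous_on {0..1} (\<lambda>t. blinfun_apply (\<omega> (a + t *\<^sub>R (b - a))) (b - a))"
proof -
  have "continuous_on {0..1} (\<lambda>t. \<omega> (a + t *\<^sub>R (b - a)))"
    by (rule continuous_on_compose2[OF assms]) (auto intro!: continuous_intros seg_point_in_segment)
  then show ?thesis by (intro continuous_intros)
qed

lemma has_integral_seg_int:
  assumes "continuous_on (closed_segment a b) \<omega>"
  shows "((\<lambda>t. blinfun_apply (\<omega> (a + t *\<^sub>R (b - a))) (b - a)) has_integral seg_int \<omega> a b) {0..1}"
  unfolding seg_int_def
  by (rule integrable_integral[OF integrable_continuous_real[OF continuous_on_seg_integrand[OF assms]]])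

lemma seg_int_primitive:
  assumes "\<And>z. z \<in> closed_segment a b \<Longrightarrow> (Q has_derivative blinfun_apply (\<omega> z)) (at z within closed_segment a b)"
  shows "seg_int \<omega> a b = Q b - Q a"
proof -
  let ?l = "\<lambda>t. a + t *\<^sub>R (b - a)"
  have "((\<lambda>t. \<omega> (?l t) (b - a)) has_integral (Q (?l 1) - Q (?l 0))) {0..1}"
  proof (rule fundamental_theorem_of_calculus)
    fix t :: real assume t: "t \<in> {0..1}"
    have 1: "(?l has_derivative (\<lambda>u. u *\<^sub>R (b - a))) (at t within {0..1})"
      by (auto intro!: derivative_eq_intros)
    have 2: "(Q has_derivative blinfun_apply (\<omega> (?l t))) (at (?l t) within ?l ` {0..1})"
      by (rule has_derivative_subset[OF assms]) (use t in \<open>auto intro!: seg_point_in_segment\<close>)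
    show "((\<lambda>t. Q (?l t)) has_vector_derivative \<omega> (?l t) (b - a)) (at t within {0..1})"
      using has_derivative_in_compose[OF 1 2]
      by (simp add: has_vector_derivative_def blinfun.scaleR_right)
  qed simp
  then show ?thesis by (simp add: seg_int_def integral_unique)
qed

lemma seg_int_diff:
  assumes "continuous_on (closed_segment a b) \<omega>" "continuous_on (closed_segment a b) \<eta>"
  shows "seg_int (\<lambda>z. \<omega> z - \<eta> z) a b = seg_int \<omega> a b - seg_int \<eta> a b"
  using has_integral_diff[OF has_integral_seg_int[OF assms(1)] has_integral_seg_int[OF assms(2)]]
  by (simp add: seg_int_def blinfun.diff_left integral_unique)

lemma norm_seg_int_le:
  assumes "continuous_on (closed_segment a b) \<omega>" and "0 \<le> e"
    and "\<And>z. z \<in> closed_segment a b \<Longrightarrow> norm (\<omega> z) \<le> e"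
  shows "norm (seg_int \<omega> a b) \<le> e * norm (b - a)"
proof -
  have "norm (seg_int \<omega> a b) \<le> (e * norm (b - a)) * measure lborel (cbox 0 (1::real))"
  proof (rule has_integral_bound)
    show "((\<lambda>t. blinfun_apply (\<omega> (a + t *\<^sub>R (b - a))) (b - a)) has_integral seg_int \<omega> a b) (cbox 0 1)"
      using has_integral_seg_int[OF assms(1)] by simp
    fix t :: real assume "t \<in> cbox 0 1"
    then have "norm (\<omega> (a + t *\<^sub>R (b - a))) \<le> e"
      by (intro assms(3) seg_point_in_segment) auto
    then show "norm (\<omega> (a + t *\<^sub>R (b - a)) (b - a)) \<le> e * norm (b - a)"
      by (meson mult_right_mono norm_blinfun norm_ge_zero order_trans)
  qed (use assms in auto)
  then show ?thesis by simp
qed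

text \<open>
  The basic estimate: the integral of a form that is uniformly close to an exact form is close to the
  increment of the primitive.  It yields both the contradiction in Goursat's argument (with a quadratic
  \<open>Q\<close>) and the differentiability of the integral from a base point (with a linear \<open>Q\<close>).
\<close>

lemma seg_int_near_primitive:
  assumes "continuous_on (closed_segment a b) \<omega>" "continuous_on (closed_segment a b) \<eta>"
    and "\<And>z. z \<in> closed_segment a b \<Longrightarrow> (Q has_derivative blinfun_apply (\<eta> z)) (at z within closed_segment a b)"
    and "\<And>z. z \<in> closed_segment a b \<Longrightarrow> norm (\<omega> z - \<eta> z) \<le> e" and "0 \<le> e"
  shows "norm (seg_int \<omega> a b - (Q b - Q a)) \<le> e * norm (b - a)"
  using norm_seg_int_le[of a b "\<lambda>z. \<omega> z - \<eta> z" e] assms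
  by (simp add: seg_int_diff seg_int_primitive[OF assms(3)] continuous_on_diff)

text \<open>
  Along a fixed segment, the form pulls back to a continuous function of one real variable, and \<open>\<Phi>\<close> is an
  antiderivative of it.  Reversal and subdivision of segments follow from this one fact.
\<close>

lemma seg_int_reparam:
  assumes "continuous_on (closed_segment a b) \<omega>"
  shows "\<exists>\<Phi>. \<forall>s\<in>{0..1}. \<forall>s'\<in>{0..1}.
    seg_int \<omega> (a + s *\<^sub>R (b - a)) (a + s' *\<^sub>R (b - a)) = \<Phi> s' - \<Phi> s"
proof -
  let ?\<phi> = "\<lambda>t. \<omega> (a + t *\<^sub>R (b - a)) (b - a)"
  obtain \<Phi> where \<Phi>: "\<And>t. t \<in> {0..1} \<Longrightarrow> (\<Phi> has_vector_derivative ?\<phi> t) (at t within {0..1})"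
    using antiderivative_continuous[OF continuous_on_seg_integrand[OF assms]] by auto
  have "seg_int \<omega> (a + s *\<^sub>R (b - a)) (a + s' *\<^sub>R (b - a)) = \<Phi> s' - \<Phi> s"
    if s: "s \<in> {0..1}" and s': "s' \<in> {0..1}" for s s'
  proof -
    let ?l = "\<lambda>t. s + t * (s' - s)"
    have l01: "?l t \<in> {0..1}" if "t \<in> {0..1}" for t
    proof -
      have "s + t *\<^sub>R (s' - s) \<in> closed_segment s s'"
        by (rule seg_point_in_segment[OF that])
      moreover have "closed_segment s s' \<subseteq> {0..1}"
        using s s' by (simp add: closed_segment_subset)
      ultimately show ?thesis by auto
    qed
    have "((\<lambda>t. (s' - s) *\<^sub>R ?\<phi> (?l t)) has_integral (\<Phi> (?l 1) - \<Phi> (?l 0))) {0..1}"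
    proof (rule fundamental_theorem_of_calculus)
      fix t :: real assume t: "t \<in> {0..1}"
      have 1: "(?l has_derivative (\<lambda>u. u * (s' - s))) (at t within {0..1})"
        by (auto intro!: derivative_eq_intros)
      have "(\<Phi> has_derivative (\<lambda>u. u *\<^sub>R ?\<phi> (?l t))) (at (?l t) within {0..1})"
        using \<Phi>[OF l01[OF t]] by (simp add: has_vector_derivative_def)
      then have 2: "(\<Phi> has_derivative (\<lambda>u. u *\<^sub>R ?\<phi> (?l t))) (at (?l t) within ?l ` {0..1})"
        by (rule has_derivative_subset) (use l01 in blast)
      show "((\<lambda>t. \<Phi> (?l t)) has_vector_derivative (s' - s) *\<^sub>R ?\<phi> (?l t)) (at t within {0..1})"
        unfolding has_vector_derivative_def
        using has_derivative_in_compose[OF 1 2] by (simp only: scaleR_scaleR)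
    qed simp
    moreover have "(s' - s) *\<^sub>R ?\<phi> (?l t)
        = \<omega> ((a + s *\<^sub>R (b - a)) + t *\<^sub>R ((a + s' *\<^sub>R (b - a)) - (a + s *\<^sub>R (b - a))))
            ((a + s' *\<^sub>R (b - a)) - (a + s *\<^sub>R (b - a)))" for t
    proof -
      have 1: "(a + s' *\<^sub>R (b - a)) - (a + s *\<^sub>R (b - a)) = (s' - s) *\<^sub>R (b - a)"
        by (simp add: scaleR_left_diff_distrib)
      have 2: "(a + s *\<^sub>R (b - a)) + t *\<^sub>R (s' - s) *\<^sub>R (b - a) = a + ?l t *\<^sub>R (b - a)"
        by (simp add: scaleR_left_distrib)
      show ?thesis by (simp only: 1 2 blinfun.scaleR_right)
    qed
    ultimately show ?thesis by (simp add: seg_int_def integral_unique)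
  qed
  then show ?thesis by blast
qed

lemma seg_int_reverse:
  assumes "continuous_on (closed_segment a b) \<omega>"
  shows "seg_int \<omega> b a = - seg_int \<omega> a b"
proof -
  obtain \<Phi> where \<Phi>: "\<And>s s'. \<lbrakk>s \<in> {0..1}; s' \<in> {0..1}\<rbrakk> \<Longrightarrow>
    seg_int \<omega> (a + s *\<^sub>R (b - a)) (a + s' *\<^sub>R (b - a)) = \<Phi> s' - \<Phi> s"
    using seg_int_reparam[OF assms] by blast
  show ?thesis using \<Phi>[of 0 1] \<Phi>[of 1 0] by simp
qed

lemma seg_int_midpoint:
  assumes "continuous_on (closed_segment a b) \<omega>"
  shows "seg_int \<omega> a b = seg_int \<omega> a (midpoint a b) + seg_int \<omega> (midpoint a b) b"
proof -
  obtain \<Phi> where \<Phi>: "\<And>s s'. \<lbrakk>s \<in> {0..1}; s' \<in> {0..1}\<rbrakk> \<Longrightarrow>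
    seg_int \<omega> (a + s *\<^sub>R (b - a)) (a + s' *\<^sub>R (b - a)) = \<Phi> s' - \<Phi> s"
    using seg_int_reparam[OF assms] by blast
  have m: "midpoint a b = a + (1/2) *\<^sub>R (b - a)"
    by (simp add: euclidean_eq_iff[where 'a='a] midpoint_def inner_simps field_simps)
  show ?thesis using \<Phi>[of 0 1] \<Phi>[of 0 "1/2"] \<Phi>[of "1/2" 1] by (simp add: m)
qed

section \<open>Goursat's lemma for closed one-forms\<close>

definition tri_int :: "('a::euclidean_space \<Rightarrow> 'a \<Rightarrow>\<^sub>L 'b::banach) \<Rightarrow> 'a \<Rightarrow> 'a \<Rightarrow> 'a \<Rightarrow> 'b" where
  "tri_int \<omega> a b c = seg_int \<omega> a b + seg_int \<omega> b c + seg_int \<omega> c a"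

text \<open>
  The sides of the medial triangle are traversed twice in opposite directions and cancel.
\<close>

lemma tri_int_subdivide:
  assumes cont: "continuous_on (convex hull {a, b, c}) \<omega>"
  shows "tri_int \<omega> a b c =
      tri_int \<omega> a (midpoint a b) (midpoint c a) + tri_int \<omega> (midpoint a b) b (midpoint b c)
    + tri_int \<omega> (midpoint c a) (midpoint b c) c
    + tri_int \<omega> (midpoint b c) (midpoint c a) (midpoint a b)"
proof -
  let ?C = "convex hull {a, b, c}"
  have V: "a \<in> ?C" "b \<in> ?C" "c \<in> ?C" by (auto intro: hull_inc)
  have mid: "midpoint x y \<in> ?C" if "x \<in> ?C" "y \<in> ?C" for x y
    using closed_segment_subset[OF that convex_convex_hull] midpoint_in_closed_segment by blast
  have seg: "continuous_on (closed_segment x y) \<omega>" if "x \<in> ?C" "y \<in> ?C" for x y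
    by (rule continuous_on_subset[OF cont closed_segment_subset[OF that convex_convex_hull]])
  note M = mid[OF V(1,2)] mid[OF V(2,3)] mid[OF V(3,1)]
  show ?thesis
    using seg_int_midpoint[OF seg[OF V(1,2)]] seg_int_midpoint[OF seg[OF V(2,3)]]
      seg_int_midpoint[OF seg[OF V(3,1)]]
      seg_int_reverse[OF seg[OF M(1,2)]] seg_int_reverse[OF seg[OF M(2,3)]]
      seg_int_reverse[OF seg[OF M(3,1)]]
    by (simp add: tri_int_def)
qed

lemma dist_midpoints:
  fixes a b c :: "'a::real_normed_vector"
  shows "dist (midpoint a b) (midpoint a c) = dist b c / 2"
proof -
  have "midpoint a b - midpoint a c = (1/2) *\<^sub>R (b - c)"
    by (simp add: midpoint_def scaleR_right_diff_distrib scaleR_right_distrib)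
  then show ?thesis by (simp add: dist_norm)
qed

text \<open>
  By pigeonhole: one of the four triangles, all of half the size, carries at least a quarter of the integral.
\<close>

lemma tri_int_large_quarter:
  fixes \<omega> :: "'a::euclidean_space \<Rightarrow> 'a \<Rightarrow>\<^sub>L 'b::banach"
  assumes cont: "continuous_on (convex hull {a, b, c}) \<omega>"
    and big: "4 * e \<le> norm (tri_int \<omega> a b c)"
    and d: "dist a b \<le> K" "dist b c \<le> K" "dist c a \<le> K"
  obtains a' b' c' where "convex hull {a', b', c'} \<subseteq> convex hull {a, b, c}"
    "dist a' b' \<le> K / 2" "dist b' c' \<le> K / 2" "dist c' a' \<le> K / 2"
    "e \<le> norm (tri_int \<omega> a' b' c')"
proof -
  define x y z where "x = midpoint b c" and "y = midpoint c a" and "z = midpoint a b"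
  let ?C = "convex hull {a, b, c}"
  have V: "a \<in> ?C" "b \<in> ?C" "c \<in> ?C" by (auto intro: hull_inc)
  have mid: "midpoint p q \<in> ?C" if "p \<in> ?C" "q \<in> ?C" for p q
    using closed_segment_subset[OF that convex_convex_hull] midpoint_in_closed_segment by blast
  have M: "x \<in> ?C" "y \<in> ?C" "z \<in> ?C" using mid V by (auto simp: x_def y_def z_def)
  have sub: "convex hull {p, q, u} \<subseteq> ?C" if "p \<in> ?C" "q \<in> ?C" "u \<in> ?C" for p q u
    by (rule hull_minimal) (use that in auto)
  have D: "dist x y = dist a b / 2" "dist y z = dist b c / 2" "dist z x = dist c a / 2"
    using dist_midpoints[of c b a] dist_midpoints[of a c b] dist_midpoints[of b a c]
    by (simp_all add: x_def y_def z_def midpoint_sym dist_commute)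
  have H: "dist a z = dist a b / 2" "dist z b = dist a b / 2" "dist b x = dist b c / 2"
    "dist x c = dist b c / 2" "dist c y = dist c a / 2" "dist y a = dist c a / 2"
    by (simp_all add: x_def y_def z_def dist_midpoint)
  have "tri_int \<omega> a b c = tri_int \<omega> a z y + tri_int \<omega> z b x + tri_int \<omega> y x c + tri_int \<omega> x y z"
    using tri_int_subdivide[OF cont] by (simp add: x_def y_def z_def)
  then have "norm (tri_int \<omega> a b c) \<le>
      norm (tri_int \<omega> a z y) + norm (tri_int \<omega> z b x) + norm (tri_int \<omega> y x c) + norm (tri_int \<omega> x y z)"
    by (simp only:) (intro order_trans[OF norm_triangle_ineq] add_mono order_refl)
  with big consider "e \<le> norm (tri_int \<omega> a z y)" | "e \<le> norm (tri_int \<omega> z b x)"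
    | "e \<le> norm (tri_int \<omega> y x c)" | "e \<le> norm (tri_int \<omega> x y z)" by linarith
  then show thesis
  proof cases
    case 1 then show ?thesis by (rule that[of a z y, rotated 4]) (use sub V M D H d in \<open>auto simp: dist_commute\<close>)
  next
    case 2 then show ?thesis by (rule that[of z b x, rotated 4]) (use sub V M D H d in \<open>auto simp: dist_commute\<close>)
  next
    case 3 then show ?thesis by (rule that[of y x c, rotated 4]) (use sub V M D H d in \<open>auto simp: dist_commute\<close>)
  next
    case 4 then show ?thesis by (rule that[of x y z, rotated 4]) (use sub V M D H d in \<open>auto simp: dist_commute\<close>)
  qed
qed

text \<open>
  Closedness is required pointwise and without continuity of the derivative: \<open>d\<omega> = 0\<close> says that the
  derivative \<open>B\<close>, viewed as a bilinear map, is symmetric.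
\<close>

definition closed_form_on :: "'a::euclidean_space set \<Rightarrow> ('a \<Rightarrow> 'a \<Rightarrow>\<^sub>L 'b::banach) \<Rightarrow> bool" where
  "closed_form_on S \<omega> \<longleftrightarrow> (\<forall>x\<in>S. \<exists>B. (\<omega> has_derivative B) (at x within S) \<and>
     (\<forall>u v. blinfun_apply (B u) v = blinfun_apply (B v) u))"

lemma closed_form_on_continuous: "closed_form_on S \<omega> \<Longrightarrow> continuous_on S \<omega>"
  unfolding closed_form_on_def continuous_on_eq_continuous_within
  using has_derivative_continuous by blast

lemma closed_form_on_subset: "closed_form_on S \<omega> \<Longrightarrow> T \<subseteq> S \<Longrightarrow> closed_form_on T \<omega>"
  unfolding closed_form_on_def by (meson has_derivative_subset subset_iff)

text \<open>
  The symmetry of \<open>B\<close> enters here: it makes the first-order Taylor polynomial of a closed form exact, with an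
  explicit quadratic primitive.
\<close>

lemma linear_part_primitive:
  fixes A :: "'a::euclidean_space \<Rightarrow>\<^sub>L 'b::banach"
  assumes B: "bounded_linear B" and sym: "\<And>u v. blinfun_apply (B u) v = blinfun_apply (B v) u"
  shows "((\<lambda>w. A w + (1/2) *\<^sub>R B (w - x) (w - x)) has_derivative blinfun_apply (A + B (z - x))) (at z within S)"
proof -
  have 1: "((\<lambda>w. B (w - x)) has_derivative (\<lambda>h. B h)) (at z within S)"
    by (rule bounded_linear.has_derivative[OF B]) (auto intro!: derivative_eq_intros)
  show ?thesis
    by (rule has_derivative_eq_rhs, (rule derivative_intros 1)+)
       (auto simp: fun_eq_iff blinfun.add_left sym[of _ "z - x"] simp flip: scaleR_left_distrib)
qed

text \<open>
  If the integral were not zero, repeated subdivision would give nested triangles of diameter at most \<open>K / 2^n\<close>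
  with integral at least \<open>\<epsilon> / 4^n\<close>.  At their common point \<open>x\<close> the first-order Taylor polynomial of the form
  contributes nothing, and the remainder contributes \<open>o(1 / 4^n)\<close>.
\<close>

lemma goursat_triangle:
  fixes \<omega> :: "'a::euclidean_space \<Rightarrow> 'a \<Rightarrow>\<^sub>L 'b::banach"
  assumes "closed_form_on (convex hull {a, b, c}) \<omega>"
  shows "tri_int \<omega> a b c = 0"
proof (rule ccontr)
  assume nz: "tri_int \<omega> a b c \<noteq> 0"
  define \<epsilon> where "\<epsilon> = norm (tri_int \<omega> a b c)"
  have \<epsilon>: "\<epsilon> > 0" using nz by (simp add: \<epsilon>_def)
  define K where "K = dist a b + dist b c + dist c a + 1"
  have K: "K > 0" by (simp add: K_def add_nonneg_pos)
  let ?C = "convex hull {a, b, c}"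
  note cont = closed_form_on_continuous[OF assms]
  define P where "P n x = (case x of (a', b', c') \<Rightarrow> convex hull {a', b', c'} \<subseteq> ?C
    \<and> dist a' b' \<le> K / 2^n \<and> dist b' c' \<le> K / 2^n \<and> dist c' a' \<le> K / 2^n
    \<and> \<epsilon> / 4^n \<le> norm (tri_int \<omega> a' b' c'))" for n :: nat and x
  define Q where "Q x y = (case x of (a', b', c') \<Rightarrow> case y of (a'', b'', c'') \<Rightarrow>
    convex hull {a'', b'', c''} \<subseteq> convex hull {a', b', c'})" for x y :: "'a \<times> 'a \<times> 'a"
  have "\<exists>f. \<forall>n. P n (f n) \<and> Q (f n) (f (Suc n))"
  proof (rule dependent_nat_choice)
    have "P 0 (a, b, c)" by (simp add: P_def \<epsilon>_def K_def)
    then show "\<exists>x. P 0 x" by blast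
    fix x n assume Px: "P n x"
    obtain a' b' c' where x: "x = (a', b', c')" by (cases x) auto
    have "continuous_on (convex hull {a', b', c'}) \<omega>"
      by (rule continuous_on_subset[OF cont]) (use Px x P_def in auto)
    moreover have "4 * (\<epsilon> / 4^Suc n) \<le> norm (tri_int \<omega> a' b' c')"
      using Px x P_def by auto
    moreover have "dist a' b' \<le> K / 2^n" "dist b' c' \<le> K / 2^n" "dist c' a' \<le> K / 2^n"
      using Px x P_def by auto
    ultimately obtain a'' b'' c'' where "convex hull {a'', b'', c''} \<subseteq> convex hull {a', b', c'}"
       "dist a'' b'' \<le> K / 2^n / 2" "dist b'' c'' \<le> K / 2^n / 2" "dist c'' a'' \<le> K / 2^n / 2"
       "\<epsilon> / 4^Suc n \<le> norm (tri_int \<omega> a'' b'' c'')"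
      by (rule tri_int_large_quarter)
    moreover have "convex hull {a', b', c'} \<subseteq> ?C" using Px x P_def by auto
    ultimately have "P (Suc n) (a'', b'', c'') \<and> Q x (a'', b'', c'')"
      unfolding P_def Q_def x by (auto simp: mult.commute)
    then show "\<exists>y. P (Suc n) y \<and> Q x y" by blast
  qed
  then obtain f where f: "\<And>n. P n (f n)" "\<And>n. Q (f n) (f (Suc n))" by blast
  define T where "T n = convex hull {fst (f n), fst (snd (f n)), snd (snd (f n))}" for n
  have Tdec: "T (Suc n) \<subseteq> T n" for n
    using f(2)[of n] by (simp add: T_def Q_def split: prod.splits)
  have "\<Inter> (range T) \<noteq> {}"
  proof (rule compact_nest)
    show "compact (T n)" for n unfolding T_def by (intro finite_imp_compact_convex_hull) simp
    show "T n \<noteq> {}" for n by (simp add: T_def)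
    show "T n \<subseteq> T m" if "m \<le> n" for m n by (rule lift_Suc_antimono_le[where f=T, OF Tdec that])
  qed
  then obtain x where x: "\<And>n. x \<in> T n" by blast
  have TC: "T n \<subseteq> ?C" for n using f(1)[of n] by (simp add: T_def P_def split: prod.splits)
  then have "x \<in> ?C" using x by blast
  then obtain B where B: "(\<omega> has_derivative B) (at x within ?C)"
      and sym: "\<And>u v. blinfun_apply (B u) v = blinfun_apply (B v) u"
    using assms unfolding closed_form_on_def by blast
  \<comment> \<open>The three sides together contribute at most \<open>3 e (K / 2^n)\<^sup>2\<close>, which is \<open>3/4\<close> of the lower bound.\<close>
  define e where "e = \<epsilon> / (4 * K\<^sup>2)"
  have e: "e > 0" using \<epsilon> K by (simp add: e_def)
  obtain \<delta> where \<delta>: "\<delta> > 0" 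
    and err: "\<And>y. y \<in> ?C \<Longrightarrow> norm (y - x) < \<delta> \<Longrightarrow> norm (\<omega> y - \<omega> x - B (y - x)) \<le> e * norm (y - x)"
    using B e unfolding has_derivative_within_alt by blast
  obtain n where n: "K / 2^n < \<delta>"
  proof -
    obtain n where "K / \<delta> < 2^n" using real_arch_pow[of 2 "K/\<delta>"] by auto
    then have "K / 2^n < \<delta>" using \<delta> by (simp add: field_simps)
    then show ?thesis by (rule that)
  qed
  obtain a' b' c' where fn: "f n = (a', b', c')" by (cases "f n") auto
  have d: "dist a' b' \<le> K / 2^n" "dist b' c' \<le> K / 2^n" "dist c' a' \<le> K / 2^n"
    and big: "\<epsilon> / 4^n \<le> norm (tri_int \<omega> a' b' c')" using f(1)[of n] by (auto simp: P_def fn)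
  have Tn: "T n = convex hull {a', b', c'}" by (simp add: T_def fn)
  \<comment> \<open>The triangle lies within \<open>K / 2^n\<close> of each of its points, in particular of \<open>x\<close>: this holds for its vertices, hence for all points by convexity.\<close>
  have "T n \<subseteq> cball a' (K/2^n)" "T n \<subseteq> cball b' (K/2^n)" "T n \<subseteq> cball c' (K/2^n)"
    unfolding Tn by (rule hull_minimal; use d K in \<open>auto simp: dist_commute\<close>)+
  then have "a' \<in> cball x (K/2^n)" "b' \<in> cball x (K/2^n)" "c' \<in> cball x (K/2^n)"
    using x[of n] by (auto simp: dist_commute)
  then have Tx: "T n \<subseteq> cball x (K/2^n)"
    unfolding Tn by (intro hull_minimal) auto
  have V: "a' \<in> T n" "b' \<in> T n" "c' \<in> T n" unfolding Tn by (auto intro: hull_inc)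
  define R where "R w = \<omega> x w + (1/2) *\<^sub>R B (w - x) (w - x)" for w
  have side: "norm (seg_int \<omega> u v - (R v - R u)) \<le> e * (K/2^n) * (K/2^n)"
    if uv: "u \<in> T n" "v \<in> T n" "dist u v \<le> K/2^n" for u v
  proof -
    have S: "closed_segment u v \<subseteq> T n"
      using closed_segment_subset[OF uv(1,2)] by (simp add: Tn)
    have "norm (seg_int \<omega> u v - (R v - R u)) \<le> e * (K/2^n) * norm (v - u)"
    proof (rule seg_int_near_primitive)
      show "continuous_on (closed_segment u v) \<omega>"
        by (rule continuous_on_subset[OF cont]) (use S TC in blast)
      have BL: "bounded_linear B" by (rule has_derivative_bounded_linear[OF B])
      show "continuous_on (closed_segment u v) (\<lambda>z. \<omega> x + B (z - x))"
        by (intro continuous_intros bounded_linear.continuous_on[OF BL])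
      show "(R has_derivative blinfun_apply (\<omega> x + B (z - x))) (at z within closed_segment u v)" for z
        unfolding R_def by (rule linear_part_primitive[OF BL sym])
      fix z assume z: "z \<in> closed_segment u v"
      then have zx: "norm (z - x) \<le> K/2^n" using S Tx by (auto simp: dist_norm norm_minus_commute)
      have "norm (\<omega> z - \<omega> x - B (z - x)) \<le> e * norm (z - x)"
        by (rule err) (use z S TC zx n in auto)
      also have "\<dots> \<le> e * (K/2^n)" using zx e by (intro mult_left_mono) auto
      finally show "norm (\<omega> z - (\<omega> x + B (z - x))) \<le> e * (K/2^n)" by (simp add: algebra_simps)
    qed (use e K in auto)
    also have "\<dots> \<le> e * (K/2^n) * (K/2^n)"
      using uv(3) e K by (intro mult_left_mono) (auto simp: dist_norm norm_minus_commute)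
    finally show ?thesis .
  qed
  have "tri_int \<omega> a' b' c' = (seg_int \<omega> a' b' - (R b' - R a')) + (seg_int \<omega> b' c' - (R c' - R b'))
      + (seg_int \<omega> c' a' - (R a' - R c'))" by (simp add: tri_int_def)
  then have "norm (tri_int \<omega> a' b' c') \<le> norm (seg_int \<omega> a' b' - (R b' - R a'))
      + norm (seg_int \<omega> b' c' - (R c' - R b')) + norm (seg_int \<omega> c' a' - (R a' - R c'))"
    by (simp only:) (intro order_trans[OF norm_triangle_ineq] add_mono order_refl)
  also have "\<dots> \<le> e * (K/2^n) * (K/2^n) + e * (K/2^n) * (K/2^n) + e * (K/2^n) * (K/2^n)"
    by (intro add_mono side V d)
  also have "\<dots> = (3/4) * (\<epsilon> / 4^n)"
    using K by (simp add: e_def field_simps power2_eq_square flip: power_mult_distrib)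
  also have "\<dots> < \<epsilon> / 4^n" using \<epsilon> by (simp add: field_simps)
  finally show False using big by simp
qed

text \<open>
  The primitive is the integral along the segment from a base point \<open>a\<close>; by Goursat's lemma for the triangle
  \<open>a, z, y\<close> its increment from \<open>z\<close> to \<open>y\<close> is the integral over the segment between them.
\<close>

theorem closed_form_has_primitive_on_convex:
  fixes \<omega> :: "'a::euclidean_space \<Rightarrow> 'a \<Rightarrow>\<^sub>L 'b::banach"
  assumes "open S" "convex S" and closed: "closed_form_on S \<omega>"
  shows "\<exists>Q. \<forall>z\<in>S. (Q has_derivative blinfun_apply (\<omega> z)) (at z)"
proof (cases "S = {}")
  case False
  then obtain a where a: "a \<in> S" by blast
  note cont = closed_form_on_continuous[OF closed]
  have incr: "seg_int \<omega> a y - seg_int \<omega> a z = seg_int \<omega> z y" if yz: "z \<in> S" "y \<in> S" for y z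
  proof -
    have "convex hull {a, z, y} \<subseteq> S" by (rule hull_minimal) (use a yz assms in auto)
    then have "tri_int \<omega> a z y = 0" by (intro goursat_triangle closed_form_on_subset[OF closed])
    moreover have "seg_int \<omega> y a = - seg_int \<omega> a y"
      by (intro seg_int_reverse continuous_on_subset[OF cont] closed_segment_subset a yz assms)
    ultimately show ?thesis by (simp add: tri_int_def algebra_simps)
  qed
  have "(seg_int \<omega> a has_derivative blinfun_apply (\<omega> z)) (at z)" if z: "z \<in> S" for z
    unfolding has_derivative_at_alt
  proof (intro conjI allI impI)
    show "bounded_linear (blinfun_apply (\<omega> z))" by (rule blinfun.bounded_linear_right)
    fix e :: real assume e: "e > 0"
    have "continuous (at z) \<omega>"
      using cont z assms(1) continuous_on_eq_continuous_at by blast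
    then obtain d1 where d1: "d1 > 0" "\<And>w. dist w z < d1 \<Longrightarrow> dist (\<omega> w) (\<omega> z) < e"
      unfolding continuous_at_eps_delta using e by blast
    obtain d2 where d2: "d2 > 0" "ball z d2 \<subseteq> S" using assms(1) z openE by blast
    show "\<exists>d>0. \<forall>y. norm (y - z) < d \<longrightarrow>
        norm (seg_int \<omega> a y - seg_int \<omega> a z - blinfun_apply (\<omega> z) (y - z)) \<le> e * norm (y - z)"
    proof (intro exI[of _ "min d1 d2"] conjI allI impI)
      fix y assume y: "norm (y - z) < min d1 d2"
      have S: "closed_segment z y \<subseteq> ball z (min d1 d2)"
        by (rule closed_segment_subset) (use y d1 d2 in \<open>auto simp: dist_norm norm_minus_commute\<close>)
      have yS: "y \<in> S" using y d2 by (auto simp: dist_norm norm_minus_commute)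
      have "norm (seg_int \<omega> z y - (\<omega> z y - \<omega> z z)) \<le> e * norm (y - z)"
      proof (rule seg_int_near_primitive)
        show "continuous_on (closed_segment z y) \<omega>"
          by (rule continuous_on_subset[OF cont]) (use S d2 subset_ball[of "min d1 d2" d2 z] in force)
        show "(blinfun_apply (\<omega> z) has_derivative blinfun_apply (\<omega> z)) (at w within closed_segment z y)" for w
          by (rule bounded_linear_imp_has_derivative) (rule blinfun.bounded_linear_right)
        fix w assume "w \<in> closed_segment z y"
        then have "dist w z < d1" using S by (auto simp: dist_commute)
        then show "norm (\<omega> w - \<omega> z) \<le> e" using d1(2)[of w] by (simp add: dist_norm)
      qed (use e in auto)
      then show "norm (seg_int \<omega> a y - seg_int \<omega> a z - \<omega> z (y - z)) \<le> e * norm (y - z)"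
        using incr[OF z yS] by (simp add: blinfun.diff_right)
    qed (use d1 d2 in auto)
  qed
  then show ?thesis by blast
qed auto

section \<open>Exactness on simply connected open sets\<close>

text \<open>
  The integral over the polygon inscribed in the path \<open>g\<close> with vertices at the multiples of \<open>1/N\<close>.  Continuous paths
  need not be rectifiable, so these sums stand in for the integral along \<open>g\<close>.  They may be meaningless for small
  \<open>N\<close>, when the polygon leaves the domain of the form.
\<close>

definition grid_sum :: "('a::euclidean_space \<Rightarrow> 'a \<Rightarrow>\<^sub>L 'b::banach) \<Rightarrow> nat \<Rightarrow> (real \<Rightarrow> 'a) \<Rightarrow> 'b" where
  "grid_sum \<omega> N g = (\<Sum>k<N. seg_int \<omega> (g (k / N)) (g (Suc k / N)))"

lemma seg_int_in_convex:
  assumes "\<And>z. z \<in> S \<Longrightarrow> (Q has_derivative blinfun_apply (\<omega> z)) (at z)"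
    and "convex S" "x \<in> S" "y \<in> S"
  shows "seg_int \<omega> x y = Q y - Q x"
proof (rule seg_int_primitive)
  fix z assume "z \<in> closed_segment x y"
  then have "z \<in> S" using closed_segment_subset[OF assms(3,4,2)] by blast
  then show "(Q has_derivative blinfun_apply (\<omega> z)) (at z within closed_segment x y)"
    by (rule has_derivative_at_withinI[OF assms(1)])
qed

lemma grid_sum_linepath:
  assumes "\<And>z. z \<in> S \<Longrightarrow> (Q has_derivative blinfun_apply (\<omega> z)) (at z)"
    and "convex S" "x \<in> S" "y \<in> S" "N > 0"
  shows "grid_sum \<omega> N (linepath x y) = Q y - Q x"
proof -
  have S: "linepath x y (k / N) \<in> S" if "k \<le> N" for k :: nat
  proof -
    have "linepath x y (k / N) \<in> closed_segment x y"
      by (rule linepath_in_path) (use that assms in auto)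
    then show ?thesis using closed_segment_subset assms by blast
  qed
  have "grid_sum \<omega> N (linepath x y) = (\<Sum>k<N. Q (linepath x y (Suc k / N)) - Q (linepath x y (k / N)))"
    unfolding grid_sum_def
    by (intro sum.cong refl seg_int_in_convex[of S, OF assms(1,2)] S) auto
  also have "\<dots> = Q y - Q x"
    using sum_lessThan_telescope[of "\<lambda>k. Q (linepath x y (k / N))" N] assms(5)
    by (simp add: linepath_def)
  finally show ?thesis .
qed

lemma grid_sum_join:
  assumes "pathfinish p = pathstart q" "N > 0"
  shows "grid_sum \<omega> (2 * N) (p +++ q) = grid_sum \<omega> N p + grid_sum \<omega> N q"
proof -
  let ?f = "\<lambda>k. seg_int \<omega> ((p +++ q) (real k / real (2 * N))) ((p +++ q) (real (Suc k) / real (2 * N)))"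
  have "grid_sum \<omega> (2 * N) (p +++ q) = (\<Sum>k<N + N. ?f k)"
    unfolding grid_sum_def by (rule sum.cong) auto
  also have "\<dots> = (\<Sum>k<N. ?f k) + (\<Sum>k<N. ?f (k + N))"
  proof -
    have "(\<Sum>k<N + M. ?f k) = (\<Sum>k<N. ?f k) + (\<Sum>k<M. ?f (k + N))" for M
      by (induction M) (simp_all add: ac_simps del: of_nat_Suc of_nat_add)
    then show ?thesis .
  qed
  also have "(\<Sum>k<N. ?f k) = grid_sum \<omega> N p"
    unfolding grid_sum_def
  proof (rule sum.cong[OF refl])
    fix k assume k: "k \<in> {..<N}"
    have "(p +++ q) (real j / real (2 * N)) = p (j / N)" if "j \<le> N" for j :: nat
      using that assms(2) by (simp add: joinpaths_def field_simps)
    then show "?f k = seg_int \<omega> (p (k / N)) (p (Suc k / N))"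
      using k by (simp del: of_nat_Suc)
  qed
  also have "(\<Sum>k<N. ?f (k + N)) = grid_sum \<omega> N q"
    unfolding grid_sum_def
  proof (rule sum.cong[OF refl])
    fix k assume k: "k \<in> {..<N}"
    have *: "(p +++ q) (real (j + N) / real (2 * N)) = q (j / N)" for j :: nat
    proof (cases "j = 0")
      case True then show ?thesis
        using assms by (simp add: joinpaths_def pathfinish_def pathstart_def)
    next
      case False
      then have "\<not> real (j + N) / real (2 * N) \<le> 1/2" using assms(2) by (simp add: field_simps)
      moreover have "2 * (real (j + N) / real (2 * N)) - 1 = j / N" using assms(2) by (simp add: field_simps)
      ultimately show ?thesis unfolding joinpaths_def by (simp only: if_False)
    qed
    show "?f (k + N) = seg_int \<omega> (q (k / N)) (q (Suc k / N))"
      using *[of k] *[of "Suc k"] by (simp only: add_Suc)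
  qed
  finally show ?thesis .
qed

text \<open>
  All balls inside \<open>U\<close> are considered, not only small ones: their radius can then be chosen uniformly, as the
  distance from a compact path or homotopy to the complement of \<open>U\<close>.
\<close>

definition exact_on_balls :: "'a::euclidean_space set \<Rightarrow> ('a \<Rightarrow> 'a \<Rightarrow>\<^sub>L 'b::banach) \<Rightarrow> bool" where
  "exact_on_balls U \<omega> \<longleftrightarrow> (\<forall>x e. ball x e \<subseteq> U \<longrightarrow>
     (\<exists>Q. \<forall>z\<in>ball x e. (Q has_derivative blinfun_apply (\<omega> z)) (at z)))"

text \<open>
  Once the grid is so fine that \<open>g\<close> stays in one ball of \<open>U\<close> over each cell, the sum over a cell telescopes to
  an increment of a primitive on that ball, whichever refinement is used.
\<close>

lemma grid_sum_refine:
  assumes U: "open U" and ex: "exact_on_balls U \<omega>"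
    and g: "path g" "path_image g \<subseteq> U"
  obtains N0 where "N0 > 0" "\<And>N M. \<lbrakk>N0 \<le> N; M > 0\<rbrakk> \<Longrightarrow> grid_sum \<omega> (N * M) g = grid_sum \<omega> N g"
proof -
  obtain \<epsilon> where \<epsilon>: "\<epsilon> > 0" "(\<Union>x\<in>path_image g. ball x \<epsilon>) \<subseteq> U"
    using compact_subset_open_imp_ball_epsilon_subset[OF compact_path_image[OF g(1)] U g(2)] by blast
  have "uniformly_continuous_on {0..1} g"
    using compact_uniformly_continuous g(1) unfolding path_def by blast
  then obtain \<delta> where \<delta>: "\<delta> > 0"
    "\<And>s t. \<lbrakk>s \<in> {0..1}; t \<in> {0..1}; dist s t < \<delta>\<rbrakk> \<Longrightarrow> dist (g s) (g t) < \<epsilon>"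
    unfolding uniformly_continuous_on_def using \<epsilon>(1) by meson
  obtain N0 :: nat where N0: "N0 > 0" "1 / N0 < \<delta>"
    using real_arch_inverse[of \<delta>] \<delta>(1) by (auto simp: inverse_eq_divide)
  have "grid_sum \<omega> (N * M) g = grid_sum \<omega> N g" if N: "N0 \<le> N" and M: "M > 0" for N M
  proof -
    have "1 / real N \<le> 1 / real N0" using N N0 by (simp add: frac_le)
    then have N1: "N > 0" "1 / N < \<delta>" using N N0 by linarith+
    let ?f = "\<lambda>i. seg_int \<omega> (g (i / (N * M))) (g (Suc i / (N * M)))"
    have "grid_sum \<omega> (N * M) g = (\<Sum>k<N. \<Sum>i=k*M..<k*M + M. ?f i)"
      by (simp add: grid_sum_def sum.nat_group)
    also have "\<dots> = grid_sum \<omega> N g"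
      unfolding grid_sum_def
    proof (rule sum.cong[OF refl])
      fix k assume k: "k \<in> {..<N}"
      let ?B = "ball (g (k / N)) \<epsilon>"
      have "?B \<subseteq> U" using \<epsilon>(2) k by (force simp: path_image_def)
      then obtain Q where Q: "\<And>z. z \<in> ?B \<Longrightarrow> (Q has_derivative blinfun_apply (\<omega> z)) (at z)"
        using ex unfolding exact_on_balls_def by meson
      have inB: "g (i / (N * M)) \<in> ?B" if i: "k * M \<le> i" "i \<le> k * M + M" for i :: nat
      proof -
        have 1: "i \<le> N * M"
        proof -
          have "i \<le> Suc k * M" using i by simp
          also have "\<dots> \<le> N * M" using k by (intro mult_right_mono) auto
          finally show ?thesis .
        qed
        have 2: "real k / N \<le> i / (N * M)"
          using i(1) M N1 by (simp add: field_simps flip: of_nat_mult)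
        have "real i / (N * M) \<le> (k * M + M) / (N * M)"
          using i(2) by (intro divide_right_mono) (auto simp flip: of_nat_mult of_nat_add)
        also have "\<dots> = real k / N + 1 / N" using M N1 by (simp add: field_simps)
        finally have "dist (k / N) (i / (N * M)) < \<delta>" using 2 N1 by (simp add: dist_real_def)
        moreover have "real i / (N * M) \<in> {0..1}" using 1 M N1 by (simp add: divide_le_eq flip: of_nat_mult)
        moreover have "real k / N \<in> {0..1}" using k by simp
        ultimately show ?thesis using \<delta>(2) by simp
      qed
      have "(\<Sum>i=k*M..<k*M + M. ?f i) =
          (\<Sum>i=k*M..<k*M + M. Q (g (Suc i / (N * M))) - Q (g (i / (N * M))))"
        by (intro sum.cong refl seg_int_in_convex[of ?B, OF Q] inB) auto
      also have "\<dots> = Q (g ((k*M + M) / (N * M))) - Q (g ((k*M) / (N * M)))"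
        using sum_Suc_diff'[of "k*M" "k*M+M" "\<lambda>i. Q (g (i / (N * M)))"] by simp
      also have "(k*M + M) / (N * M) = (Suc k / N :: real)" using M N1 by (simp add: field_simps)
      also have "(k*M) / (N * M) = (k / N :: real)" using M N1 by (simp add: field_simps)
      also have "Q (g (Suc k / N)) - Q (g (k / N)) = seg_int \<omega> (g (k / N)) (g (Suc k / N))"
      proof (rule seg_int_in_convex[of ?B, OF Q, symmetric])
        have "(k*M + M) / (N * M) = (Suc k / N :: real)" using M N1 by (simp add: field_simps)
        then show "g (Suc k / N) \<in> ?B" using inB[of "k*M + M"] by simp
      qed (use \<epsilon> in auto)
      finally show "(\<Sum>i=k*M..<k*M + M. ?f i) = seg_int \<omega> (g (k / N)) (g (Suc k / N))" .
    qed
    finally show ?thesis .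
  qed
  then show thesis using N0(1) that by blast
qed

text \<open>
  The value at which the grid sums become stationary.
\<close>

definition path_val :: "('a::euclidean_space \<Rightarrow> 'a \<Rightarrow>\<^sub>L 'b::banach) \<Rightarrow> (real \<Rightarrow> 'a) \<Rightarrow> 'b" where
  "path_val \<omega> g = (SOME c. \<forall>\<^sub>F N in sequentially. grid_sum \<omega> N g = c)"

lemma eventually_grid_sum:
  assumes "open U" "exact_on_balls U \<omega>" "path g" "path_image g \<subseteq> U"
  shows "\<forall>\<^sub>F N in sequentially. grid_sum \<omega> N g = path_val \<omega> g"
proof -
  obtain N0 where N0: "N0 > 0" "\<And>N M. \<lbrakk>N0 \<le> N; M > 0\<rbrakk> \<Longrightarrow> grid_sum \<omega> (N * M) g = grid_sum \<omega> N g"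
    using grid_sum_refine[OF assms] by blast
  \<comment> \<open>Both sums agree with the one over the common refinement with \<open>N * N0\<close> cells.\<close>
  have "grid_sum \<omega> N g = grid_sum \<omega> N0 g" if "N \<ge> N0" for N
    using N0(2)[of N N0] N0(2)[of N0 N] N0(1) that by (simp add: mult.commute)
  then have "\<exists>c. \<forall>\<^sub>F N in sequentially. grid_sum \<omega> N g = c"
    unfolding eventually_sequentially by blast
  then show ?thesis unfolding path_val_def by (rule someI_ex)
qed

text \<open>
  On a fine grid of the unit square, each cell is mapped into a ball of \<open>U\<close> on which the form has a primitive,
  so the sum around the cell vanishes.  Passing from one row of the grid to the next therefore changes the grid sum by
  the integrals along the vertical sides at both ends, which are zero as the end points stay fixed.
\<close>

lemma grid_sum_homotopic:
  assumes U: "open U" and ex: "exact_on_balls U \<omega>" and hom: "homotopic_paths U p q"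
  shows "\<forall>\<^sub>F N in sequentially. grid_sum \<omega> N p = grid_sum \<omega> N q"
proof -
  obtain H where H: "continuous_on ({0..1} \<times> {0..1}) H" "H ` ({0..1} \<times> {0..1}) \<subseteq> U"
    and H0: "\<And>x. x \<in> {0..1} \<Longrightarrow> H (0, x) = p x" and H1: "\<And>x. x \<in> {0..1} \<Longrightarrow> H (1, x) = q x"
    and He: "\<And>t. t \<in> {0..1::real} \<Longrightarrow> H (t, 0) = p 0" "\<And>t. t \<in> {0..1::real} \<Longrightarrow> H (t, 1) = p 1"
    using hom unfolding homotopic_paths pathstart_def pathfinish_def o_def by (auto simp: image_subset_iff_funcset)
  let ?I = "{0..1::real} \<times> {0..1::real}"
  have compI: "compact ?I" by (intro compact_Times) auto
  obtain \<epsilon> where \<epsilon>: "\<epsilon> > 0" "(\<Union>x\<in>H ` ?I. ball x \<epsilon>) \<subseteq> U"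
    using compact_subset_open_imp_ball_epsilon_subset[OF compact_continuous_image[OF H(1) compI] U H(2)] by blast
  obtain \<delta> where \<delta>: "\<delta> > 0" "\<And>s t. \<lbrakk>s \<in> ?I; t \<in> ?I; dist s t < \<delta>\<rbrakk> \<Longrightarrow> dist (H s) (H t) < \<epsilon>"
    using compact_uniformly_continuous[OF H(1) compI] \<epsilon>(1) unfolding uniformly_continuous_on_def by meson
  obtain N0 :: nat where N0: "N0 > 0" "1 / N0 < \<delta> / 2"
    using real_arch_inverse[of "\<delta> / 2"] \<delta>(1) by (auto simp: inverse_eq_divide)
  have "grid_sum \<omega> N p = grid_sum \<omega> N q" if N: "N0 \<le> N" for N
  proof -
    have "1 / real N \<le> 1 / real N0" using N N0 by (simp add: frac_le)
    then have N1: "N > 0" "1 / N < \<delta> / 2" using N N0 by linarith+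
    define h where "h j k = H (real j / N, real k / N)" for j k :: nat
    have I: "(real j / N, real k / N) \<in> ?I" if "j \<le> N" "k \<le> N" for j k :: nat
      using that N1 by simp
    have row: "(\<Sum>k<N. seg_int \<omega> (h (Suc j) k) (h (Suc j) (Suc k))) = (\<Sum>k<N. seg_int \<omega> (h j k) (h j (Suc k)))"
      if j: "j < N" for j
    proof -
      let ?V = "\<lambda>k. seg_int \<omega> (h j k) (h (Suc j) k)"
      have "seg_int \<omega> (h (Suc j) k) (h (Suc j) (Suc k)) - seg_int \<omega> (h j k) (h j (Suc k)) = ?V (Suc k) - ?V k"
        if k: "k < N" for k
      proof -
        let ?B = "ball (h j k) \<epsilon>"
        have "?B \<subseteq> U" using \<epsilon>(2) I[of j k] j k unfolding h_def by force
        then obtain Q where Q: "\<And>z. z \<in> ?B \<Longrightarrow> (Q has_derivative blinfun_apply (\<omega> z)) (at z)"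
          using ex unfolding exact_on_balls_def by meson
        have near: "h j' k' \<in> ?B" if "j' \<in> {j, Suc j}" "k' \<in> {k, Suc k}" for j' k'
        proof -
          have a: "\<bar>real j / N - real j' / N\<bar> \<le> 1 / N" "\<bar>real k / N - real k' / N\<bar> \<le> 1 / N"
            using that N1 by (auto simp flip: diff_divide_distrib)
          have "dist (real j / N, real k / N) (real j' / N, real k' / N)
              \<le> \<bar>real j / N - real j' / N\<bar> + \<bar>real k / N - real k' / N\<bar>"
            unfolding dist_Pair_Pair dist_real_def by (rule sqrt_sum_squares_le_sum_abs[THEN order_trans]) simp
          then have "dist (real j / N, real k / N) (real j' / N, real k' / N) < \<delta>"
            using a N1 by linarith
          then show ?thesis unfolding h_def using \<delta>(2) I[of j k] I[of j' k'] that j k \<epsilon>(1) by auto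
        qed
        have D: "seg_int \<omega> (h j1 k1) (h j2 k2) = Q (h j2 k2) - Q (h j1 k1)"
          if "j1 \<in> {j, Suc j}" "k1 \<in> {k, Suc k}" "j2 \<in> {j, Suc j}" "k2 \<in> {k, Suc k}" for j1 k1 j2 k2
          by (intro seg_int_in_convex[of ?B, OF Q convex_ball] near that)
        show ?thesis by (simp add: D)
      qed
      then have "(\<Sum>k<N. seg_int \<omega> (h (Suc j) k) (h (Suc j) (Suc k)) - seg_int \<omega> (h j k) (h j (Suc k)))
          = ?V N - ?V 0"
        using sum_lessThan_telescope[of ?V N] by simp
      also have "\<dots> = 0"
      proof -
        have "seg_int \<omega> z z = 0" for z by (simp add: seg_int_def)
        moreover have "h (Suc j) 0 = h j 0" "h (Suc j) N = h j N"
          using He I[of j 0] I[of "Suc j" 0] j N1 unfolding h_def by auto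
        ultimately show ?thesis by simp
      qed
      finally show ?thesis by (simp add: sum_subtractf)
    qed
    have "(\<Sum>k<N. seg_int \<omega> (h j k) (h j (Suc k))) = (\<Sum>k<N. seg_int \<omega> (h 0 k) (h 0 (Suc k)))" if "j \<le> N" for j
      using that by (induction j) (auto simp: row)
    from this[of N] have "(\<Sum>k<N. seg_int \<omega> (h N k) (h N (Suc k))) = (\<Sum>k<N. seg_int \<omega> (h 0 k) (h 0 (Suc k)))"
      by simp
    moreover have "h 0 k = p (real k / N)" "h N k = q (real k / N)" if "k \<le> N" for k
      using H0 H1 I[of 0 k] N1 that unfolding h_def by auto
    ultimately show ?thesis by (simp add: grid_sum_def del: of_nat_Suc)
  qed
  then show ?thesis unfolding eventually_sequentially by blast
qed

text \<open>
  The value of the primitive at \<open>x\<close> is the value along any path from \<open>x0\<close> to \<open>x\<close>.  For \<open>y\<close> in a ball around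
  \<open>x\<close>, the path to \<open>x\<close> followed by a segment is homotopic to the path to \<open>y\<close>, so near \<open>x\<close> the
  primitive is a local one up to a constant.
\<close>

theorem exact_on_balls_imp_exact:
  assumes U: "open U" and sc: "simply_connected U" and ex: "exact_on_balls U \<omega>"
  shows "\<exists>h. \<forall>z\<in>U. (h has_derivative blinfun_apply (\<omega> z)) (at z)"
proof (cases "U = {}")
  case False
  then obtain x0 where x0: "x0 \<in> U" by blast
  define P where "P x = (SOME g. path g \<and> path_image g \<subseteq> U \<and> pathstart g = x0 \<and> pathfinish g = x)" for x
  have P: "path (P x) \<and> path_image (P x) \<subseteq> U \<and> pathstart (P x) = x0 \<and> pathfinish (P x) = x" if "x \<in> U" for x
  proof -
    have "\<exists>g. path g \<and> path_image g \<subseteq> U \<and> pathstart g = x0 \<and> pathfinish g = x"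
      using simply_connected_imp_path_connected[OF sc] x0 that unfolding path_connected_def by blast
    then show ?thesis unfolding P_def by (rule someI_ex)
  qed
  define h where "h x = path_val \<omega> (P x)" for x
  have "(h has_derivative blinfun_apply (\<omega> x)) (at x)" if x: "x \<in> U" for x
  proof -
    obtain e where e: "e > 0" "ball x e \<subseteq> U" using U x openE by blast
    then obtain Q where Q: "\<And>z. z \<in> ball x e \<Longrightarrow> (Q has_derivative blinfun_apply (\<omega> z)) (at z)"
      using ex unfolding exact_on_balls_def by meson
    have hQ: "h y = h x + (Q y - Q x)" if y: "y \<in> ball x e" for y
    proof -
      have yU: "y \<in> U" using y e by blast
      let ?g = "P x +++ linepath x y"
      have seg: "closed_segment x y \<subseteq> U"
        using closed_segment_subset[of x "ball x e" y] y e by auto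
      have g: "path ?g" "path_image ?g \<subseteq> U" "pathstart ?g = x0" "pathfinish ?g = y"
        using P[OF x] seg by (auto simp: path_image_join)
      have "homotopic_paths U ?g (P y)"
        using sc g P[OF yU] unfolding simply_connected_eq_homotopic_paths by auto
      then have "\<forall>\<^sub>F N in sequentially. grid_sum \<omega> N ?g = grid_sum \<omega> N (P y)"
        by (rule grid_sum_homotopic[OF U ex])
      moreover have "\<forall>\<^sub>F N in sequentially. grid_sum \<omega> N (P x) = h x"
        "\<forall>\<^sub>F N in sequentially. grid_sum \<omega> N (P y) = h y"
        using P[OF x] P[OF yU] unfolding h_def by (blast intro: eventually_grid_sum[OF U ex])+
      ultimately have "\<forall>\<^sub>F N in sequentially. grid_sum \<omega> N ?g = h y \<and> grid_sum \<omega> N (P x) = h x"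
        by eventually_elim auto
      then obtain N0 where N0: "\<And>N. N \<ge> N0 \<Longrightarrow> grid_sum \<omega> N ?g = h y \<and> grid_sum \<omega> N (P x) = h x"
        unfolding eventually_sequentially by blast
      \<comment> \<open>An even number of cells makes the junction of the two paths a grid point.\<close>
      have "h y = grid_sum \<omega> (2 * Suc N0) ?g" using N0[of "2 * Suc N0"] by simp
      also have "\<dots> = grid_sum \<omega> (Suc N0) (P x) + grid_sum \<omega> (Suc N0) (linepath x y)"
        by (rule grid_sum_join) (use P[OF x] in auto)
      also have "\<dots> = h x + (Q y - Q x)"
        using N0[of "Suc N0"] grid_sum_linepath[of "ball x e", OF Q convex_ball _ y, of x "Suc N0"] e by simp
      finally show ?thesis .
    qed
    have "((\<lambda>y. h x + (Q y - Q x)) has_derivative blinfun_apply (\<omega> x)) (at x)"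
      using Q[of x] e by (auto intro!: derivative_eq_intros)
    then show ?thesis
    proof (rule has_derivative_transform_within_open[OF _ open_ball])
      show "x \<in> ball x e" using e by simp
      show "h x + (Q y - Q x) = h y" if "y \<in> ball x e" for y by (rule hQ[OF that, symmetric])
    qed
  qed
  then show ?thesis by blast
qed auto

lemma closed_form_exact_on_balls:
  assumes "closed_form_on U \<omega>"
  shows "exact_on_balls U \<omega>"
  unfolding exact_on_balls_def
  using closed_form_has_primitive_on_convex closed_form_on_subset[OF assms] by auto

section \<open>Line integrals along piecewise differentiable curves\<close>

text \<open>
  Integrability is a local property, and locally the integrand is the derivative of \<open>Q \<circ> \<gamma>\<close> off a finite set for
  a local primitive \<open>Q\<close>.  Exactness cannot be dropped: the velocity of \<open>\<gamma>\<close> need not be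
  absolutely integrable, and a continuous factor can destroy its integrability.
\<close>

lemma closed_line_integral_integrable:
  fixes \<omega> :: "'a::euclidean_space \<Rightarrow> 'a \<Rightarrow>\<^sub>L 'b::banach"
  assumes U: "open U" and ex: "exact_on_balls U \<omega>"
    and \<gamma>: "\<gamma> piecewise_differentiable_on {0..a}" "\<gamma> ` {0..a} \<subseteq> U"
  shows "(\<lambda>\<tau>. blinfun_apply (\<omega> (\<gamma> \<tau>)) (vector_derivative \<gamma> (at \<tau> within {0..a}))) integrable_on {0..a}"
    (is "?f integrable_on _")
proof -
  obtain S where S: "finite S" "\<And>\<tau>. \<tau> \<in> {0..a} - S \<Longrightarrow> \<gamma> differentiable (at \<tau> within {0..a})"
    using \<gamma>(1) unfolding piecewise_differentiable_on_def by blast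
  have cont: "continuous_on {0..a} \<gamma>" using \<gamma>(1) by (rule piecewise_differentiable_on_imp_continuous_on)
  have "?f integrable_on cbox 0 a"
  proof (rule integrable_on_little_subintervals, rule ballI)
    fix x assume x: "x \<in> cbox 0 a"
    then have "\<gamma> x \<in> U" using \<gamma>(2) by auto
    then obtain e where e: "e > 0" "ball (\<gamma> x) e \<subseteq> U" using U openE by blast
    then obtain Q where Q: "\<And>z. z \<in> ball (\<gamma> x) e \<Longrightarrow> (Q has_derivative blinfun_apply (\<omega> z)) (at z)"
      using ex unfolding exact_on_balls_def by meson
    obtain d where d: "d > 0" "\<And>y. y \<in> {0..a} \<Longrightarrow> dist y x < d \<Longrightarrow> dist (\<gamma> y) (\<gamma> x) < e"
      using cont[unfolded continuous_on_iff, rule_format, of x e] x e(1) by auto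
    show "\<exists>d>0. \<forall>u v. x \<in> cbox u v \<and> cbox u v \<subseteq> ball x d \<and> cbox u v \<subseteq> cbox 0 a \<longrightarrow> ?f integrable_on cbox u v"
    proof (intro exI[of _ d] conjI allI impI d(1))
      fix u v assume "x \<in> cbox u v \<and> cbox u v \<subseteq> ball x d \<and> cbox u v \<subseteq> cbox 0 a"
      then have uv: "u \<le> v" "{u..v} \<subseteq> ball x d" "{u..v} \<subseteq> {0..a}" by auto
      have near: "\<gamma> \<tau> \<in> ball (\<gamma> x) e" if "\<tau> \<in> {u..v}" for \<tau>
      proof -
        have "dist \<tau> x < d" using that uv(2) by (auto simp: dist_commute)
        then show ?thesis using d(2)[of \<tau>] that uv(3) by (auto simp: dist_commute)
      qed
      have "(?f has_integral (Q (\<gamma> v) - Q (\<gamma> u))) {u..v}"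
      proof (rule fundamental_theorem_of_calculus_interior_strong[OF S(1) uv(1)])
        fix \<tau> assume \<tau>: "\<tau> \<in> {u<..<v} - S"
        have i: "\<tau> \<in> {0..a}" "0 < \<tau>" "\<tau> < a" using \<tau> uv by auto
        have "(\<gamma> has_vector_derivative vector_derivative \<gamma> (at \<tau> within {0..a})) (at \<tau> within {0..a})"
          using S(2)[of \<tau>] \<tau> i by (simp add: vector_derivative_works)
        then have "(\<gamma> has_derivative (\<lambda>h. h *\<^sub>R vector_derivative \<gamma> (at \<tau> within {0..a}))) (at \<tau>)"
          using at_within_Icc_at[OF i(2,3)] by (simp add: has_vector_derivative_def)
        from has_derivative_compose[OF this Q[OF near[of \<tau>]]]
        show "((\<lambda>\<tau>. Q (\<gamma> \<tau>)) has_vector_derivative ?f \<tau>) (at \<tau>)"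
          using \<tau> by (simp add: has_vector_derivative_def blinfun.scaleR_right)
      next
        have "continuous_on (ball (\<gamma> x) e) Q"
          using Q by (meson continuous_at_imp_continuous_on has_derivative_continuous)
        then show "continuous_on {u..v} (\<lambda>\<tau>. Q (\<gamma> \<tau>))"
          by (rule continuous_on_compose2) (use continuous_on_subset[OF cont uv(3)] near in auto)
      qed
      then show "?f integrable_on cbox u v" by auto
    qed
  qed
  then show ?thesis by simp
qed

section \<open>The algebra and the matrix of multiplication\<close>

context
  fixes r s t :: 3 and p :: "real^6"
  assumes rst: "{r, s, t} = {1, 2, 3}"
begin

lemma UNIV_rst: "(UNIV :: 3 set) = {r, s, t}"
  using rst UNIV_3 by simp

lemma distinct_rst: "r \<noteq> s" "r \<noteq> t" "s \<noteq> t" "s \<noteq> r" "t \<noteq> r" "t \<noteq> s"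
proof -
  have "card {r, s, t} = 3" using UNIV_rst[symmetric] by simp
  then show "r \<noteq> s" "r \<noteq> t" "s \<noteq> t" "s \<noteq> r" "t \<noteq> r" "t \<noteq> s"
    by (auto simp: card_insert_if split: if_splits)
qed

lemma sum_rst: "sum f (UNIV :: 3 set) = f r + f s + f t" for f :: "3 \<Rightarrow> 'b::comm_monoid_add"
  unfolding UNIV_rst using distinct_rst by (simp add: ac_simps)

lemma all_rst: "(\<forall>k::3. P k) \<longleftrightarrow> P r \<and> P s \<and> P t"
  using UNIV_rst by (metis UNIV_I insert_iff empty_iff)

lemma vec_eq_rst: "x = y \<longleftrightarrow> x$r = y$r \<and> x$s = y$s \<and> x$t = y$t" for x y :: "'b^3"
  unfolding vec_eq_iff all_rst ..

lemma inner_rst: "inner x y = x$r * y$r + x$s * y$s + x$t * y$t" for x y :: "real^3"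
  by (simp add: inner_vec_def sum_rst)

text \<open>
  The usual expansion is not tied to the order of the indices: permuting rows and columns simultaneously does not
  change the determinant.
\<close>

lemma det_rst:
  fixes M :: "real^3^3"
  shows "det M = M$r$r * (M$s$s * M$t$t - M$s$t * M$t$s) - M$r$s * (M$s$r * M$t$t - M$s$t * M$t$r)
     + M$r$t * (M$s$r * M$t$s - M$s$s * M$t$r)"
proof -
  have "r \<in> {1, 2, 3}" "s \<in> {1, 2, 3}" "t \<in> {1, 2, 3}" unfolding rst[symmetric] by auto
  then consider "r = 1" "s = 2" "t = 3" | "r = 1" "s = 3" "t = 2" | "r = 2" "s = 1" "t = 3"
    | "r = 2" "s = 3" "t = 1" | "r = 3" "s = 1" "t = 2" | "r = 3" "s = 2" "t = 1"
    using distinct_rst by auto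
  then show ?thesis by cases (simp_all only: det_3, simp_all add: algebra_simps)
qed

lemma amult_nth:
  "amult r s t p x y $ r = x$r * y$r + p7 p * (x$s * y$s) + p8 p * (x$s * y$t + x$t * y$s) + p9 p * (x$t * y$t)"
  "amult r s t p x y $ s = x$r * y$s + x$s * y$r + p$1 * (x$s * y$s) + p$3 * (x$s * y$t + x$t * y$s) + p$5 * (x$t * y$t)"
  "amult r s t p x y $ t = x$r * y$t + x$t * y$r + p$2 * (x$s * y$s) + p$4 * (x$s * y$t + x$t * y$s) + p$6 * (x$t * y$t)"
  using distinct_rst
  by (simp_all add: amult_def sum_rst basis_prod_def axis_def algebra_simps)

lemma amult_commute: "amult r s t p x y = amult r s t p y x"
  by (simp add: vec_eq_rst amult_nth algebra_simps)

lemma amult_unit: "amult r s t p (axis r 1) x = x"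
  using distinct_rst by (simp add: vec_eq_rst amult_nth axis_def)

text \<open>
  This is where the particular values of \<open>p7\<close>, \<open>p8\<close> and \<open>p9\<close> matter: they are exactly what associativity forces.
\<close>

lemma amult_assoc: "amult r s t p (amult r s t p x y) z = amult r s t p x (amult r s t p y z)"
  unfolding vec_eq_rst amult_nth p7_def p8_def p9_def
  by (intro conjI) algebra+

lemma bounded_bilinear_amult: "bounded_bilinear (amult r s t p)"
  unfolding bilinear_conv_bounded_bilinear[symmetric] bilinear_def
  by (auto intro!: linearI simp: vec_eq_rst amult_nth algebra_simps)

lemma mult_matrix_vector: "mult_matrix r s t p a *v x = amult r s t p a x"
  unfolding mult_matrix_def
  using matrix_vector_mul(3)[OF bounded_bilinear.bounded_linear_right[OF bounded_bilinear_amult]]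
  by (rule fun_cong)

lemma mult_matrix_nth: "mult_matrix r s t p a $ i $ j = amult r s t p (axis j 1) a $ i"
  by (simp add: mult_matrix_def matrix_def amult_commute)

lemma mult_matrix_amult:
  "mult_matrix r s t p (amult r s t p a b) = mult_matrix r s t p a ** mult_matrix r s t p b"
  by (simp add: matrix_eq mult_matrix_vector amult_assoc flip: matrix_vector_mul_assoc)

lemma mult_matrix_unit: "mult_matrix r s t p (axis r 1) = mat 1"
  by (simp add: matrix_eq mult_matrix_vector amult_unit)

lemma det_mult_matrix_nonzero_of_unit:
  assumes "amult r s t p a b = axis r 1"
  shows "det (mult_matrix r s t p a) \<noteq> 0"
proof -
  have "mult_matrix r s t p a ** mult_matrix r s t p b = mat 1"
    using assms mult_matrix_amult mult_matrix_unit by metis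
  then show ?thesis
    using det_mul[of "mult_matrix r s t p a" "mult_matrix r s t p b"] by auto
qed

lemma mult_matrix_entries:
  "mult_matrix r s t p a $ r $ r = a$r"
  "mult_matrix r s t p a $ s $ r = a$s"
  "mult_matrix r s t p a $ t $ r = a$t"
  "mult_matrix r s t p a $ r $ s = p7 p * a$s + p8 p * a$t"
  "mult_matrix r s t p a $ s $ s = a$r + p$1 * a$s + p$3 * a$t"
  "mult_matrix r s t p a $ t $ s = p$2 * a$s + p$4 * a$t"
  "mult_matrix r s t p a $ r $ t = p8 p * a$s + p9 p * a$t"
  "mult_matrix r s t p a $ s $ t = p$3 * a$s + p$5 * a$t"
  "mult_matrix r s t p a $ t $ t = a$r + p$4 * a$s + p$6 * a$t"
  using distinct_rst by (simp_all add: mult_matrix_nth amult_nth axis_def)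

section \<open>The fields dual to the columns of the matrix\<close>

text \<open>
  The field \<open>G\<^sub>k\<close> depends on the point only through the value of \<open>F\<close>; taking the identity for \<open>F\<close> exhibits it as a
  function on the algebra.
\<close>

abbreviation "dual_row \<equiv> G_field r s t p (\<lambda>x. x)"

lemma G_field_eq_dual_row: "G_field r s t p F k w = dual_row k (F w)"
  by (simp add: G_field_def)

definition "dual_matrix a = (\<chi> k. dual_row k a)"

lemma dual_row_nth:
  fixes a
  defines "D \<equiv> det (mult_matrix r s t p a)"
  shows
  "dual_row r a $ r = ((a$r)\<^sup>2 + (p$1 + p$4) * a$r * a$s + (p$3 + p$6) * a$r * a$t + (p$1 * p$4 - p$2 * p$3) * (a$s)\<^sup>2
            + (p$1 * p$6 - p$2 * p$5) * a$s * a$t + (p$3 * p$6 - p$4 * p$5) * (a$t)\<^sup>2) / D"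
  "dual_row r a $ s = (- p7 p * a$r * a$s - p8 p * a$r * a$t + (p$2 * p8 p - p$4 * p7 p) * (a$s)\<^sup>2
            + (p$2 * p9 p - p$6 * p7 p) * a$s * a$t + (p$5 * p7 p - p$3 * p8 p) * (a$t)\<^sup>2) / D"
  "dual_row r a $ t = (- p8 p * a$r * a$s - p9 p * a$r * a$t + (p$2 * p9 p - p$4 * p8 p) * (a$s)\<^sup>2
            + (p$5 * p7 p - p$1 * p9 p) * a$s * a$t + (p$5 * p8 p - p$3 * p9 p) * (a$t)\<^sup>2) / D"
  "dual_row s a $ r = (- a$r * a$s - p$4 * (a$s)\<^sup>2 - (p$6 - p$3) * a$s * a$t + p$5 * (a$t)\<^sup>2) / D"
  "dual_row s a $ s = ((a$r)\<^sup>2 + p$4 * a$r * a$s + p$6 * a$r * a$t - p8 p * a$s * a$t - p9 p * (a$t)\<^sup>2) / D"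
  "dual_row s a $ t = - (p$3 * a$r * a$s - p8 p * (a$s)\<^sup>2 + p$5 * a$r * a$t - p9 p * a$s * a$t) / D"
  "dual_row t a $ r = (p$2 * (a$s)\<^sup>2 - a$r * a$t - (p$1 - p$4) * a$s * a$t - p$3 * (a$t)\<^sup>2) / D"
  "dual_row t a $ s = - (p$2 * a$r * a$s + p$4 * a$r * a$t - p7 p * a$s * a$t - p8 p * (a$t)\<^sup>2) / D"
  "dual_row t a $ t = ((a$r)\<^sup>2 + p$1 * a$r * a$s + p$3 * a$r * a$t - p7 p * (a$s)\<^sup>2 - p8 p * a$s * a$t) / D"
  unfolding D_def using distinct_rst
  by (simp_all add: G_field_def Let_def axis_def)

text \<open>
  Cramer's rule: the numerators of \<open>dual_row j\<close> are the cofactors along column \<open>j\<close> of the multiplication matrix.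
  After clearing the denominator \<open>D\<close>, each of the nine cases is a polynomial identity, and it is independent of
  the order of \<open>r, s, t\<close>.
\<close>

lemma dual_row_inner:
  assumes "det (mult_matrix r s t p a) \<noteq> 0"
  shows "inner (amult r s t p (axis i 1) a) (dual_row j a) = (if i = j then 1 else 0)"
proof -
  define D where "D = det (mult_matrix r s t p a)"
  have D: "D \<noteq> 0" using assms by (simp add: D_def)
  have Deq: "D = a$r * ((a$r + p$1 * a$s + p$3 * a$t) * (a$r + p$4 * a$s + p$6 * a$t) - (p$3 * a$s + p$5 * a$t) * (p$2 * a$s + p$4 * a$t))
     - (p7 p * a$s + p8 p * a$t) * (a$s * (a$r + p$4 * a$s + p$6 * a$t) - (p$3 * a$s + p$5 * a$t) * a$t)
     + (p8 p * a$s + p9 p * a$t) * (a$s * (p$2 * a$s + p$4 * a$t) - (a$r + p$1 * a$s + p$3 * a$t) * a$t)"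
    unfolding D_def det_rst mult_matrix_entries ..
  have "inner (amult r s t p (axis i 1) a) (dual_row j a) =
     mult_matrix r s t p a $ r $ i * dual_row j a $ r + mult_matrix r s t p a $ s $ i * dual_row j a $ s
     + mult_matrix r s t p a $ t $ i * dual_row j a $ t" for i j
    by (simp add: inner_rst mult_matrix_nth)
  note I = this
  have div: "x * (y / D) + x' * (y' / D) + x'' * (y'' / D) = (if b then 1 else 0)"
    if "x * y + x' * y' + x'' * y'' = (if b then D else 0)" for x y x' y' x'' y'' b
    using that D by (auto simp: field_simps)
  have "\<forall>i j. inner (amult r s t p (axis i 1) a) (dual_row j a) = (if i = j then 1 else 0)"
    unfolding all_rst I dual_row_nth D_def[symmetric] mult_matrix_entries
    by (intro conjI; rule div;
        simp only: simp_thms distinct_rst if_True if_False Deq p7_def p8_def p9_def; algebra)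
  then show ?thesis by blast
qed


lemma dual_matrix_inverse:
  assumes "det (mult_matrix r s t p a) \<noteq> 0"
  shows "dual_matrix a ** mult_matrix r s t p a = mat 1" "mult_matrix r s t p a ** dual_matrix a = mat 1"
proof -
  have "(dual_matrix a ** mult_matrix r s t p a) $ j $ i = inner (amult r s t p (axis i 1) a) (dual_row j a)" for i j
    by (simp add: matrix_matrix_mult_def dual_matrix_def inner_vec_def mult_matrix_nth mult.commute)
  then show "dual_matrix a ** mult_matrix r s t p a = mat 1"
    by (simp add: vec_eq_iff dual_row_inner[OF assms] mat_def eq_commute)
  then show "mult_matrix r s t p a ** dual_matrix a = mat 1"
    using matrix_left_right_inverse by blast
qed

lemma ainverse_eqI:
  assumes "amult r s t p a b = axis r 1"
  shows "ainverse r s t p a = b"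
  unfolding ainverse_def
proof (rule the_equality)
  show "amult r s t p a b = axis r 1" by (rule assms)
next
  fix c assume c: "amult r s t p a c = axis r 1"
  have "c = amult r s t p (amult r s t p a b) c" by (simp add: assms amult_unit)
  also have "\<dots> = amult r s t p b (amult r s t p a c)" by (metis amult_assoc amult_commute)
  also have "\<dots> = b" by (metis c amult_unit amult_commute)
  finally show "c = b" .
qed

text \<open>
  By associativity, multiplication by the inverse element is the inverse of the multiplication matrix.
\<close>

lemma ainverse_dual_matrix:
  assumes "det (mult_matrix r s t p a) \<noteq> 0"
  shows "amult r s t p a (ainverse r s t p a) = axis r 1"
    and "amult r s t p (ainverse r s t p a) v = dual_matrix a *v v"
proof -
  note inv = dual_matrix_inverse[OF assms]
  have mult: "amult r s t p a (dual_matrix a *v v) = v" for v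
    by (simp add: inv matrix_vector_mul_assoc flip: mult_matrix_vector)
  from ainverse_eqI[OF mult] show unit: "amult r s t p a (ainverse r s t p a) = axis r 1"
    using mult by simp
  have "amult r s t p (ainverse r s t p a) v = amult r s t p (ainverse r s t p a) (amult r s t p a (dual_matrix a *v v))"
    by (simp add: mult)
  also have "\<dots> = amult r s t p (amult r s t p a (ainverse r s t p a)) (dual_matrix a *v v)"
    by (metis amult_assoc amult_commute)
  finally show "amult r s t p (ainverse r s t p a) v = dual_matrix a *v v"
    by (simp add: unit amult_unit)
qed

lemma ainverse_mult_nth:
  assumes "det (mult_matrix r s t p a) \<noteq> 0"
  shows "amult r s t p (ainverse r s t p a) v $ k = inner (dual_row k a) v"
  unfolding ainverse_dual_matrix(2)[OF assms]
  by (simp add: matrix_vector_mult_def dual_matrix_def inner_vec_def)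

lemma aunits_iff: "a \<in> aunits r s t p \<longleftrightarrow> det (mult_matrix r s t p a) \<noteq> 0"
  unfolding aunits_def using det_mult_matrix_nonzero_of_unit ainverse_dual_matrix(1) by blast

section \<open>Inversion is differentiable\<close>

lemma differentiable_det_mult_matrix:
  "(\<lambda>a. det (mult_matrix r s t p a)) differentiable (at a within S)"
  unfolding det_rst mult_matrix_entries
  by (intro differentiable_add differentiable_diff differentiable_mult differentiable_const
      bounded_linear_imp_differentiable[OF bounded_linear_vec_nth])

lemma open_aunits: "open (aunits r s t p)"
proof -
  have "continuous_on UNIV (\<lambda>a. det (mult_matrix r s t p a))"
    by (rule differentiable_imp_continuous_on)
       (simp add: differentiable_on_def differentiable_det_mult_matrix)
  then have "open ((\<lambda>a. det (mult_matrix r s t p a)) -` (- {0}))"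
    using open_vimage by blast
  moreover have "aunits r s t p = (\<lambda>a. det (mult_matrix r s t p a)) -` (- {0})"
    using aunits_iff by auto
  ultimately show ?thesis by simp
qed

text \<open>
  The components of \<open>e/a\<close> are those of the dual rows in direction \<open>r\<close>, since \<open>e/a = (e/a) e\<^sub>r\<close>; these are
  rational functions with denominator \<open>det R(a)\<close>.
\<close>

lemma differentiable_ainverse:
  assumes a: "a \<in> aunits r s t p"
  shows "ainverse r s t p differentiable (at a)"
proof -
  have D: "det (mult_matrix r s t p a) \<noteq> 0" using a by (simp add: aunits_iff)
  have "\<forall>k. (\<lambda>b. dual_row k b $ r) differentiable (at a)"
    unfolding all_rst dual_row_nth
    by (intro conjI differentiable_add differentiable_diff differentiable_minus differentiable_mult
        differentiable_divide differentiable_power differentiable_const D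
        bounded_linear_imp_differentiable[OF bounded_linear_vec_nth] differentiable_det_mult_matrix)
  then have "(\<lambda>b. \<Sum>k\<in>UNIV. dual_row k b $ r *\<^sub>R axis k 1) differentiable (at a)"
    by (intro differentiable_sum differentiable_scaleR differentiable_const) auto
  then obtain f' where f': "((\<lambda>b. \<Sum>k\<in>UNIV. dual_row k b $ r *\<^sub>R axis k (1::real)) has_derivative f') (at a)"
    unfolding differentiable_def by blast
  have "(ainverse r s t p has_derivative f') (at a)"
  proof (rule has_derivative_transform_within_open[OF f' open_aunits a])
    fix b assume b: "b \<in> aunits r s t p"
    have "ainverse r s t p b = dual_matrix b *v axis r 1"
      using ainverse_dual_matrix(2)[of b "axis r 1"] b
      by (simp add: aunits_iff amult_commute[of _ "axis r 1"] amult_unit)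
    then have "ainverse r s t p b $ k = dual_row k b $ r" for k
      by (simp add: matrix_vector_mul_component dual_matrix_def inner_axis)
    then show "(\<Sum>k\<in>UNIV. dual_row k b $ r *\<^sub>R axis k 1) = ainverse r s t p b"
      by (simp add: vec_eq_iff axis_def if_distrib[of "(*) _"] cong: if_cong)
  qed
  then show ?thesis unfolding differentiable_def by blast
qed

text \<open>
  Differentiability is known, so the form of the derivative follows from the product rule for \<open>F (e/F) = e\<close>, an
  identity that holds near \<open>w\<close> because the units form an open set.
\<close>

lemma has_derivative_ainverse_compose:
  assumes F: "(F has_derivative F') (at w)" and w: "F w \<in> aunits r s t p"
  shows "((\<lambda>x. ainverse r s t p (F x)) has_derivative
    (\<lambda>h. - amult r s t p (ainverse r s t p (F w)) (amult r s t p (ainverse r s t p (F w)) (F' h)))) (at w)"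
proof -
  let ?m = "amult r s t p" and ?i = "\<lambda>x. ainverse r s t p (F x)"
  obtain g where "(ainverse r s t p has_derivative g) (at (F w))"
    using differentiable_ainverse[OF w] unfolding differentiable_def by blast
  from has_derivative_compose[OF F this] obtain f' where f': "(?i has_derivative f') (at w)"
    by blast
  have unit: "?m (F x) (?i x) = axis r 1" if "F x \<in> aunits r s t p" for x
    using that by (simp add: aunits_iff ainverse_dual_matrix(1))
  have prod: "((\<lambda>x. ?m (F x) (?i x)) has_derivative (\<lambda>h. ?m (F w) (f' h) + ?m (F' h) (?i w))) (at w)"
    by (rule bounded_bilinear.FDERIV[OF bounded_bilinear_amult F f'])
  have "isCont F w" using F has_derivative_continuous by blast
  then have "\<forall>\<^sub>F x in at w. F x \<in> aunits r s t p"
    using open_aunits w by (metis continuous_within topological_tendstoD)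
  then have "\<forall>\<^sub>F x in at w. axis r 1 = ?m (F x) (?i x)"
    by (rule eventually_mono) (simp add: unit)
  from has_derivative_transform_eventually[OF has_derivative_const this]
  have "((\<lambda>x. ?m (F x) (?i x)) has_derivative (\<lambda>h. 0)) (at w)"
    using unit[OF w] by simp
  from has_derivative_unique[OF prod this]
  have 0: "?m (F w) (f' h) + ?m (F' h) (?i w) = 0" for h by metis
  have "f' h = - ?m (?i w) (?m (?i w) (F' h))" for h
  proof -
    interpret bounded_bilinear ?m by (rule bounded_bilinear_amult)
    have "f' h = ?m (?m (F w) (?i w)) (f' h)" by (simp add: unit w amult_unit)
    also have "\<dots> = ?m (?i w) (?m (F w) (f' h))" by (metis amult_assoc amult_commute)
    also have "?m (F w) (f' h) = - ?m (?i w) (F' h)"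
      using 0[of h] by (metis amult_commute add_eq_0_iff2 add.commute eq_neg_iff_add_eq_0)
    finally show ?thesis by (simp add: minus_right)
  qed
  then show ?thesis using f' by (metis (no_types, lifting) ext)
qed

section \<open>The closed form given by the inverse of an algebrizable field\<close>

definition "inverse_form F w = bounded_bilinear.prod_right (amult r s t p) (ainverse r s t p (F w))"

lemma inverse_form_apply: "blinfun_apply (inverse_form F w) v = amult r s t p (ainverse r s t p (F w)) v"
  unfolding inverse_form_def
  by (simp add: bounded_bilinear.prod_right.rep_eq[OF bounded_bilinear_amult])

lemma algebrizable_derivative:
  assumes "algebrizable_on r s t p \<Omega> F"
  obtains F' where "\<And>w. w \<in> \<Omega> \<Longrightarrow> (F has_derivative amult r s t p (F' w)) (at w)"
proof -
  obtain F' where "\<And>w. w \<in> \<Omega> \<Longrightarrow>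
      ((\<lambda>\<xi>. norm (F (w + \<xi>) - F w - amult r s t p (F' w) \<xi>) / norm \<xi>) \<longlongrightarrow> 0) (at 0)"
    using assms unfolding algebrizable_on_def by blast
  then show thesis
    by (intro that[of F'])
       (simp add: has_derivative_at bounded_bilinear.bounded_linear_right[OF bounded_bilinear_amult])
qed

lemma open_unit_domain:
  assumes "open \<Omega>" "algebrizable_on r s t p \<Omega> F"
  shows "open (unit_domain r s t p \<Omega> F)"
proof -
  obtain F' where "\<And>w. w \<in> \<Omega> \<Longrightarrow> (F has_derivative amult r s t p (F' w)) (at w)"
    using algebrizable_derivative[OF assms(2)] by blast
  then have "continuous_on \<Omega> F"
    by (meson continuous_at_imp_continuous_on has_derivative_continuous)
  then have "open (\<Omega> \<inter> F -` aunits r s t p)"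
    by (rule continuous_open_preimage[OF _ assms(1) open_aunits])
  then show ?thesis by (simp add: unit_domain_def Int_def vimage_def)
qed

text \<open>
  The derivative \<open>u \<mapsto> (v \<mapsto> - (e/F)\<^sup>2 F' u v)\<close> is symmetric by commutativity and associativity.
\<close>

lemma closed_inverse_form:
  assumes "algebrizable_on r s t p \<Omega> F"
  shows "closed_form_on (unit_domain r s t p \<Omega> F) (inverse_form F)"
  unfolding closed_form_on_def
proof
  fix w assume w: "w \<in> unit_domain r s t p \<Omega> F"
  obtain F' where F': "\<And>w. w \<in> \<Omega> \<Longrightarrow> (F has_derivative amult r s t p (F' w)) (at w)"
    using algebrizable_derivative[OF assms] by blast
  let ?m = "amult r s t p" and ?i = "ainverse r s t p (F w)"
  let ?d = "\<lambda>h. - ?m ?i (?m ?i (?m (F' w) h))"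
  interpret bounded_bilinear ?m by (rule bounded_bilinear_amult)
  have "((\<lambda>x. ainverse r s t p (F x)) has_derivative ?d) (at w within unit_domain r s t p \<Omega> F)"
    by (rule has_derivative_at_withinI[OF has_derivative_ainverse_compose[OF F']])
       (use w in \<open>auto simp: unit_domain_def\<close>)
  then have "(inverse_form F has_derivative (\<lambda>h. prod_right (?d h))) (at w within unit_domain r s t p \<Omega> F)"
    unfolding inverse_form_def by (rule bounded_linear.has_derivative[OF bounded_linear_prod_right])
  moreover have "prod_right (?d u) v = prod_right (?d v) u" for u v
    by (simp add: minus_left amult_assoc amult_commute[of u v])
  ultimately show "\<exists>B. (inverse_form F has_derivative B) (at w within unit_domain r s t p \<Omega> F) \<and>
      (\<forall>u v. blinfun_apply (B u) v = blinfun_apply (B v) u)" by blast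
qed

lemma inverse_form_nth:
  assumes "w \<in> unit_domain r s t p \<Omega> F"
  shows "blinfun_apply (inverse_form F w) v $ k = inner (G_field r s t p F k w) v"
  unfolding inverse_form_apply G_field_eq_dual_row[where F=F]
  by (rule ainverse_mult_nth) (use assms in \<open>simp add: unit_domain_def aunits_iff\<close>)

lemma E_field_G_field_dual:
  assumes "w \<in> unit_domain r s t p \<Omega> F"
  shows "inner (E_field r s t p F i w) (G_field r s t p F j w) = (if i = j then 1 else 0)"
  unfolding E_field_def G_field_eq_dual_row[where F=F]
  by (rule dual_row_inner) (use assms in \<open>simp add: unit_domain_def aunits_iff\<close>)

lemma E_field_explicit:
  "E_field r s t p F r w = F w"
  "E_field r s t p F s w =
            (p7 p * F w $ s + p8 p * F w $ t) *\<^sub>R axis r 1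
          + (F w $ r + p$1 * F w $ s + p$3 * F w $ t) *\<^sub>R axis s 1
          + (p$2 * F w $ s + p$4 * F w $ t) *\<^sub>R axis t 1"
  "E_field r s t p F t w =
            (p8 p * F w $ s + p9 p * F w $ t) *\<^sub>R axis r 1
          + (p$3 * F w $ s + p$5 * F w $ t) *\<^sub>R axis s 1
          + (F w $ r + p$4 * F w $ s + p$6 * F w $ t) *\<^sub>R axis t 1"
  unfolding E_field_def using distinct_rst
  by (simp_all add: vec_eq_rst amult_nth axis_def)

text \<open>
  The \<open>k\<close>-th component of a primitive of the vector-valued form is a potential of \<open>G\<^sub>k\<close>.
\<close>

lemma conservative_G_field:
  assumes U: "open U" "simply_connected U" "U \<subseteq> unit_domain r s t p \<Omega> F"
    and F: "algebrizable_on r s t p \<Omega> F"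
  shows "conservative_on U (G_field r s t p F k)"
proof -
  have "closed_form_on U (inverse_form F)"
    by (rule closed_form_on_subset[OF closed_inverse_form[OF F] U(3)])
  then obtain h where h: "\<And>z. z \<in> U \<Longrightarrow> (h has_derivative blinfun_apply (inverse_form F z)) (at z)"
    using exact_on_balls_imp_exact[OF U(1,2) closed_form_exact_on_balls] by blast
  have "GDERIV (\<lambda>z. h z $ k) x :> G_field r s t p F k x" if "x \<in> U" for x
    using bounded_linear.has_derivative[OF bounded_linear_vec_nth h[OF that], of k]
    by (simp add: gderiv_def inverse_form_nth[OF subsetD[OF U(3) that]] inner_commute)
  then show ?thesis unfolding conservative_on_def potential_on_def by blast
qed

lemma line_integral_ainverse:
  assumes "open \<Omega>" and F: "algebrizable_on r s t p \<Omega> F"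
    and \<gamma>: "\<gamma> piecewise_differentiable_on {0..a}" "\<gamma> ` {0..a} \<subseteq> unit_domain r s t p \<Omega> F"
  shows "alg_line_integrand r s t p a \<gamma> (\<lambda>w. ainverse r s t p (F w)) integrable_on {0..a}" (is "?f integrable_on _")
    and "line_integrand a \<gamma> (G_field r s t p F k) integrable_on {0..a}"
    and "integral {0..a} (alg_line_integrand r s t p a \<gamma> (\<lambda>w. ainverse r s t p (F w)))
          = (\<chi> k. integral {0..a} (line_integrand a \<gamma> (G_field r s t p F k)))"
proof -
  show int: "?f integrable_on {0..a}"
    using closed_line_integral_integrable[OF open_unit_domain[OF assms(1,2)]
        closed_form_exact_on_balls[OF closed_inverse_form[OF F]] \<gamma>]
    by (simp add: alg_line_integrand_def inverse_form_apply)
  have comp: "(line_integrand a \<gamma> (G_field r s t p F k) has_integral (integral {0..a} ?f $ k)) {0..a}" for k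
  proof (rule has_integral_eq)
    show "((\<lambda>\<tau>. ?f \<tau> $ k) has_integral (integral {0..a} ?f $ k)) {0..a}"
      using has_integral_linear[OF integrable_integral[OF int] bounded_linear_vec_nth[of k]]
      by (simp add: o_def)
    fix \<tau> assume "\<tau> \<in> {0..a}"
    then have "\<gamma> \<tau> \<in> unit_domain r s t p \<Omega> F" using \<gamma>(2) by blast
    from inverse_form_nth[OF this]
    show "?f \<tau> $ k = line_integrand a \<gamma> (G_field r s t p F k) \<tau>"
      by (simp add: alg_line_integrand_def line_integrand_def inverse_form_apply)
  qed
  then show "line_integrand a \<gamma> (G_field r s t p F k) integrable_on {0..a}" by blast
  show "integral {0..a} ?f = (\<chi> k. integral {0..a} (line_integrand a \<gamma> (G_field r s t p F k)))"
    by (simp add: vec_eq_iff integral_unique[OF comp])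
qed

end

section \<open>Potentials, line integrals and first integrals\<close>

theorem proposition4p1:
  fixes r s t :: 3 and p :: "real^6" and \<Omega> :: "(real^3) set" and F :: "real^3 \<Rightarrow> real^3"
  assumes rst: "{r, s, t} = {1, 2, 3}"
    and open_\<Omega>: "open \<Omega>"
    and algebrizable: "algebrizable_on r s t p \<Omega> F"
  shows
    "(\<forall>w\<in>\<Omega>.
        E_field r s t p F r w = F w
      \<and> E_field r s t p F s w =
            (p7 p * F w $ s + p8 p * F w $ t) *\<^sub>R axis r 1
          + (F w $ r + p$1 * F w $ s + p$3 * F w $ t) *\<^sub>R axis s 1
          + (p$2 * F w $ s + p$4 * F w $ t) *\<^sub>R axis t 1
      \<and> E_field r s t p F t w =
            (p8 p * F w $ s + p9 p * F w $ t) *\<^sub>R axis r 1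
          + (p$3 * F w $ s + p$5 * F w $ t) *\<^sub>R axis s 1
          + (F w $ r + p$4 * F w $ s + p$6 * F w $ t) *\<^sub>R axis t 1)
   \<and> (\<forall>(a::real) \<gamma>. 0 < a \<and> \<gamma> piecewise_differentiable_on {0..a}
          \<and> \<gamma> ` {0..a} \<subseteq> unit_domain r s t p \<Omega> F \<longrightarrow>
        alg_line_integrand r s t p a \<gamma> (\<lambda>w. ainverse r s t p (F w)) integrable_on {0..a}
      \<and> (\<forall>k. line_integrand a \<gamma> (G_field r s t p F k) integrable_on {0..a})
      \<and> integral {0..a} (alg_line_integrand r s t p a \<gamma> (\<lambda>w. ainverse r s t p (F w)))
          = (\<chi> k. integral {0..a} (line_integrand a \<gamma> (G_field r s t p F k))))
   \<and> (\<forall>U k. open U \<and> simply_connected U \<and> U \<subseteq> unit_domain r s t p \<Omega> F \<longrightarrow>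
        conservative_on U (G_field r s t p F k))
   \<and> (\<forall>w\<in>unit_domain r s t p \<Omega> F. \<forall>i j.
        inner (E_field r s t p F i w) (G_field r s t p F j w) = (if i = j then 1 else 0))
   \<and> (\<forall>U h i j. open U \<and> simply_connected U \<and> U \<subseteq> unit_domain r s t p \<Omega> F
          \<and> i \<noteq> j \<and> potential_on U (G_field r s t p F i) h \<longrightarrow>
        first_integral_on U (E_field r s t p F j) h)"
proof -
  note integrals = line_integral_ainverse[OF rst open_\<Omega> algebrizable]
  have "first_integral_on U (E_field r s t p F j) h"
    if "U \<subseteq> unit_domain r s t p \<Omega> F" "i \<noteq> j" "potential_on U (G_field r s t p F i) h" for U h i j
    unfolding first_integral_on_def
  proof
    fix x assume "x \<in> U"
    then have "GDERIV h x :> G_field r s t p F i x" and "x \<in> unit_domain r s t p \<Omega> F"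
      using that by (auto simp: potential_on_def)
    then show "\<exists>D. (GDERIV h x :> D) \<and> inner D (E_field r s t p F j x) = 0"
      using E_field_G_field_dual[OF rst] that(2) by (metis inner_commute)
  qed
  note first_integrals = this
  show ?thesis
  proof (intro conjI)
    show "\<forall>w\<in>\<Omega>.
        E_field r s t p F r w = F w
      \<and> E_field r s t p F s w =
            (p7 p * F w $ s + p8 p * F w $ t) *\<^sub>R axis r 1
          + (F w $ r + p$1 * F w $ s + p$3 * F w $ t) *\<^sub>R axis s 1
          + (p$2 * F w $ s + p$4 * F w $ t) *\<^sub>R axis t 1
      \<and> E_field r s t p F t w =
            (p8 p * F w $ s + p9 p * F w $ t) *\<^sub>R axis r 1
          + (p$3 * F w $ s + p$5 * F w $ t) *\<^sub>R axis s 1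
          + (F w $ r + p$4 * F w $ s + p$6 * F w $ t) *\<^sub>R axis t 1"
      by (intro ballI conjI E_field_explicit[OF rst])
  next
    show "\<forall>w\<in>unit_domain r s t p \<Omega> F. \<forall>i j.
        inner (E_field r s t p F i w) (G_field r s t p F j w) = (if i = j then 1 else 0)"
      by (intro ballI allI E_field_G_field_dual[OF rst])
  next
    show "\<forall>U k. open U \<and> simply_connected U \<and> U \<subseteq> unit_domain r s t p \<Omega> F \<longrightarrow>
        conservative_on U (G_field r s t p F k)"
      using conservative_G_field[OF rst _ _ _ algebrizable] by blast
  qed (use integrals first_integrals in blast)+
qed

end
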